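(* Let $n$ be a positive integer, let $0<\lambda<1$, and fix a constant $\kappa>0$. Let $\psi\colon\mathbb{R}^+\to\mathbb{R}^+$ be an approximation function and let $g$ be an increasing dimension function such that $q^{-1}g(q)$ is decreasing and $q^{-1}g(q)\to\infty$ as $q\to 0$. Let \[ \mathcal{P}_n^{\lambda}=\left\{P\in\mathbb{Z}[X]:\ \deg P\le n,\ |D(P)|\ge \kappa\, H(P)^{2(n-1-\lambda)}\right\} \] and \[ \mathcal{A}_n^{\lambda}(\psi)=\left\{x\in\mathbb{R}:\ |P(x)|\le \psi(H(P)) \text{ for infinitely many } P\in\mathcal{P}_n^{\lambda}\right\}. \] If $\sum_{q=1}^\infty g\!\left(\frac{\psi(q)}{q}\right)q^n<\infty$, then $\mathcal{H}^g(\mathcal{A}_n^{\lambda}(\psi))=0$.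
   Context: For an integer polynomial $P$, $H(P)$ (the height) is the maximum absolute value of its coefficients and $D(P)$ is its discriminant. An approximation function is a decreasing function $\psi\colon\mathbb{R}^+\to\mathbb{R}^+$. A dimension function is a continuous increasing $g\colon\mathbb{R}^+\to\mathbb{R}^+$ with $g(r)\to0$ as $r\to0$. For $X\subseteq\mathbb{R}$, $\mathcal{H}^g_\rho(X)=\inf\sum_i g(r(B_i))$ over all countable covers of $X$ by balls $B_i$ of radii $r(B_i)\in(0,\rho]$, and the Hausdorff $g$-measure is $\mathcal{H}^g(X)=\lim_{\rho\to0^+}\mathcal{H}^g_\rho(X)$. *)

theory Defs
  imports "HOL-Analysis.Analysis" "Berlekamp_Zassenhaus.Mahler_Measure"
begin

text \<open>
  The discriminant \<open>a\<^sup>2\<^sup>d\<^sup>-\<^sup>2 \<Prod>\<^sub>i\<^sub><\<^sub>j (\<alpha>\<^sub>i - \<alpha>\<^sub>j)\<^sup>2\<close>, where \<open>a\<close> is the leading coefficient and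
  \<open>\<alpha>\<^sub>0, \<dots>, \<alpha>\<^sub>d\<^sub>-\<^sub>1\<close> are the complex roots with multiplicity; \<open>d\<close> is the actual degree of the polynomial.
  Since subtraction on \<^typ>\<open>nat\<close> truncates, constant polynomials (zero included) get discriminant 1.
\<close>
definition discriminant :: "int poly \<Rightarrow> complex" where
  "discriminant P =
     of_int (lead_coeff P) ^ (2 * degree P - 2) *
     (\<Prod>j<degree P. \<Prod>i<j. (complex_roots_int P ! i - complex_roots_int P ! j)\<^sup>2)"

text \<open>
  \<open>\<real>\<^sup>+\<close> is the open half-line; functions on it are total functions on \<^typ>\<open>real\<close> whose values
  elsewhere are irrelevant. Monotonicity is not required to be strict.
\<close>
definition approximation_function :: "(real \<Rightarrow> real) \<Rightarrow> bool" where
  "approximation_function \<psi> \<longleftrightarrow> (\<forall>x>0. \<psi> x > 0) \<and> antimono_on {0<..} \<psi>"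

definition dimension_function :: "(real \<Rightarrow> real) \<Rightarrow> bool" where
  "dimension_function g \<longleftrightarrow>
     (\<forall>r>0. g r > 0) \<and> continuous_on {0<..} g \<and> mono_on {0<..} g \<and> (g \<longlongrightarrow> 0) (at_right 0)"

text \<open>Countable covers are indexed by a set \<open>I\<close> of natural numbers, so finite covers are included.\<close>
definition hausdorff_premeasure :: "(real \<Rightarrow> real) \<Rightarrow> real \<Rightarrow> real set \<Rightarrow> ennreal" where
  "hausdorff_premeasure g \<rho> X =
     Inf {\<Sum>\<^sub>\<infinity>i\<in>I. ennreal (g (r i)) | (I :: nat set) (c :: nat \<Rightarrow> real) (r :: nat \<Rightarrow> real).
            (\<forall>i\<in>I. r i \<in> {0<..\<rho>}) \<and> X \<subseteq> (\<Union>i\<in>I. ball (c i) (r i))}"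

definition hausdorff_measure :: "(real \<Rightarrow> real) \<Rightarrow> real set \<Rightarrow> ennreal" where
  "hausdorff_measure g X = Lim (at_right 0) (\<lambda>\<rho>. hausdorff_premeasure g \<rho> X)"

text \<open>The limit above always exists.\<close>
lemma hausdorff_premeasure_antimono:
  assumes "\<rho> \<le> \<rho>'"
  shows "hausdorff_premeasure g \<rho>' X \<le> hausdorff_premeasure g \<rho> X"
  unfolding hausdorff_premeasure_def
  by (rule Inf_superset_mono) (use assms in fastforce)

lemma tendsto_hausdorff_measure_SUP:
  "((\<lambda>\<rho>. hausdorff_premeasure g \<rho> X) \<longlongrightarrow> (SUP \<rho>\<in>{0<..}. hausdorff_premeasure g \<rho> X)) (at_right 0)"
proof (rule order_tendstoI)
  fix a assume "a < (SUP \<rho>\<in>{0<..}. hausdorff_premeasure g \<rho> X)"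
  then obtain \<rho> where \<rho>: "\<rho> > 0" "a < hausdorff_premeasure g \<rho> X"
    by (auto simp: less_SUP_iff)
  show "\<forall>\<^sub>F x in at_right 0. a < hausdorff_premeasure g x X"
    unfolding eventually_at_right_field
    using \<rho> hausdorff_premeasure_antimono[of _ \<rho> g X] by (metis less_imp_le less_le_trans)
next
  fix a assume a: "(SUP \<rho>\<in>{0<..}. hausdorff_premeasure g \<rho> X) < a"
  have "hausdorff_premeasure g x X < a" if "x > 0" for x
    using a SUP_upper[of x "{0<..}" "\<lambda>\<rho>. hausdorff_premeasure g \<rho> X"] that by simp
  then show "\<forall>\<^sub>F x in at_right 0. hausdorff_premeasure g x X < a"
    unfolding eventually_at_right_field by (intro exI[of _ 1]) auto
qed

lemma hausdorff_measure_eq_SUP: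
  "hausdorff_measure g X = (SUP \<rho>\<in>{0<..}. hausdorff_premeasure g \<rho> X)"
  unfolding hausdorff_measure_def
  by (rule tendsto_Lim[OF _ tendsto_hausdorff_measure_SUP]) simp

definition large_discriminant_polys :: "real \<Rightarrow> nat \<Rightarrow> real \<Rightarrow> int poly set" where
  "large_discriminant_polys \<kappa> n lam =
     {P. degree P \<le> n \<and>
         cmod (discriminant P) \<ge> \<kappa> * real_of_int (height P) powr (2 * (real n - 1 - lam))}"

definition approximable_reals :: "real \<Rightarrow> nat \<Rightarrow> real \<Rightarrow> (real \<Rightarrow> real) \<Rightarrow> real set" where
  "approximable_reals \<kappa> n lam \<psi> =
     {x. infinite {P \<in> large_discriminant_polys \<kappa> n lam.
                     \<bar>poly (of_int_poly P) x\<bar> \<le> \<psi> (real_of_int (height P))}}"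

end

theory Submission
  imports Defs
begin

text \<open>
  Put \<open>Q = 2\<^sup>k\<close> and \<open>\<delta> = \<psi>(Q)\<close>, and consider the polynomials of height between \<open>Q\<close> and \<open>2Q\<close>.
  If \<open>x\<close> is bounded, \<open>|P(x)| \<le> \<delta>\<close> and \<open>z\<close> is the root nearest to \<open>x\<close>, then the discriminant bound, with
  Landau's inequality for the Mahler measure, makes \<open>|P(x)| / |x - z|\<close> at least of order
  \<open>Q\<^sup>1\<^sup>-\<^sup>\<lambda>\<close>, and so \<open>|P'(x)|\<close> exceeds any prescribed constant \<open>T\<close> once \<open>Q\<close> is large.

  Fix all coefficients but the constant one, that is, fix \<open>R = P - P(0)\<close>; there are \<open>O(Q\<^sup>n)\<close> choices.
  The points in question have \<open>R(x)\<close> within \<open>\<delta>\<close> of an integer and \<open>|R'(x)| \<ge> T\<close>. On each of the boundedly many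
  intervals where \<open>|R'|\<close> is monotone, each integer \<open>b\<close> contributes one interval of length
  \<open>O(\<delta> / |R'(x\<^sub>b)|)\<close>, and since \<open>R\<close> moves by at least \<open>1/2\<close> between different \<open>x\<^sub>b\<close>, the sum of
  \<open>1 / |R'(x\<^sub>b)|\<close> telescopes to \<open>O(1)\<close>. As \<open>g(q)/q\<close> decreases, an interval of length \<open>\<delta>/|R'|\<close> costs at most
  \<open>O(Q/|R'|) g(\<delta>/Q)\<close>, so height \<open>Q\<close> costs \<open>O(Q\<^sup>n\<^sup>+\<^sup>1 g(\<psi>(Q)/Q))\<close> altogether,
  which is summable over the powers of two by condensation.
\<close>

subsection \<open>Countable subadditivity of the Hausdorff premeasure\<close>

lemma hausdorff_premeasure_mono:
  assumes "X \<subseteq> Y"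
  shows "hausdorff_premeasure g \<rho> X \<le> hausdorff_premeasure g \<rho> Y"
  unfolding hausdorff_premeasure_def
  by (rule Inf_superset_mono) (use assms in blast)

lemma hausdorff_premeasure_ball_le:
  assumes "X \<subseteq> ball c r" "0 < r" "r \<le> \<rho>"
  shows "hausdorff_premeasure g \<rho> X \<le> ennreal (g r)"
  unfolding hausdorff_premeasure_def
proof (rule Inf_lower, intro CollectI exI conjI)
  show "ennreal (g r) = (\<Sum>\<^sub>\<infinity>i\<in>{0::nat}. ennreal (g ((\<lambda>_. r) i)))" by simp
qed (use assms in auto)

lemma hausdorff_premeasure_empty [simp]: "hausdorff_premeasure g \<rho> {} = 0"
proof -
  have "hausdorff_premeasure g \<rho> {} \<le> (\<Sum>\<^sub>\<infinity>i\<in>({}::nat set). ennreal (g ((\<lambda>_. 0) i)))"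
    unfolding hausdorff_premeasure_def
    by (rule Inf_lower, intro CollectI exI conjI, rule refl) auto
  then show ?thesis by simp
qed

lemma infsum_ennreal_eq_suminf:
  fixes f :: "nat \<Rightarrow> ennreal"
  shows "infsum f UNIV = (\<Sum>i. f i)"
proof -
  have "(f has_sum infsum f UNIV) UNIV"
    by (intro has_sum_infsum nonneg_summable_on_complete) simp
  then show ?thesis
    using has_sum_imp_sums sums_unique by blast
qed

lemma hausdorff_premeasure_lessE:
  assumes "hausdorff_premeasure g \<rho> X < b"
  obtains I :: "nat set" and c r where "\<forall>j\<in>I. r j \<in> {0<..\<rho>}" "X \<subseteq> (\<Union>j\<in>I. ball (c j) (r j))"
    "(\<Sum>\<^sub>\<infinity>j\<in>I. ennreal (g (r j))) < b"
  using assms unfolding hausdorff_premeasure_def Inf_less_iff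
  by (elim bexE CollectE exE conjE) (rule that; assumption | simp only:)

lemma finite_sum_le_infsum_ennreal:
  fixes f :: "'a \<Rightarrow> ennreal"
  assumes "finite F" "F \<subseteq> A"
  shows "sum f F \<le> infsum f A"
proof -
  have "infsum f F \<le> infsum f A"
    using assms by (intro infsum_mono_neutral nonneg_summable_on_complete) auto
  then show ?thesis using assms by simp
qed

text \<open>A finite subset of a Sigma set is a finite union of finite fibres, so its sum stays
  below the iterated sum. This half of Tonelli's theorem suffices to bound the cost of a combined
  cover.\<close>

lemma infsum_Sigma_ennreal_le:
  fixes f :: "'a \<times> 'b \<Rightarrow> ennreal"
  shows "infsum f (Sigma A B) \<le> (\<Sum>\<^sub>\<infinity>x\<in>A. \<Sum>\<^sub>\<infinity>y\<in>B x. f (x, y))"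
proof (rule infsum_le_finite_sums)
  fix F assume F: "finite F" "F \<subseteq> Sigma A B"
  have "sum f F = (\<Sum>x\<in>fst ` F. \<Sum>y\<in>F `` {x}. f (x, y))"
  proof -
    have "F = Sigma (fst ` F) (\<lambda>x. F `` {x})" by force
    then show ?thesis using F by (simp add: sum.Sigma finite_Image)
  qed
  also have "\<dots> \<le> (\<Sum>x\<in>fst ` F. \<Sum>\<^sub>\<infinity>y\<in>B x. f (x, y))"
  proof (rule sum_mono)
    fix x
    have "finite (F `` {x})" "F `` {x} \<subseteq> B x" using F by (auto simp: finite_Image)
    then show "(\<Sum>y\<in>F `` {x}. f (x, y)) \<le> (\<Sum>\<^sub>\<infinity>y\<in>B x. f (x, y))"
      by (rule finite_sum_le_infsum_ennreal)
  qed
  also have "\<dots> \<le> (\<Sum>\<^sub>\<infinity>x\<in>A. \<Sum>\<^sub>\<infinity>y\<in>B x. f (x, y))"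
    using F by (intro finite_sum_le_infsum_ennreal) auto
  finally show "sum f F \<le> (\<Sum>\<^sub>\<infinity>x\<in>A. \<Sum>\<^sub>\<infinity>y\<in>B x. f (x, y))" .
qed (intro nonneg_summable_on_complete, simp)

lemma hausdorff_premeasure_UN_le:
  "hausdorff_premeasure g \<rho> (\<Union>i::nat. Y i) \<le> (\<Sum>i. hausdorff_premeasure g \<rho> (Y i))"
\<comment> \<open>Covers optimal up to \<open>d i\<close> come from the strict inequality v < v +
  \<open>d i\<close>, which fails when v is infinite.\<close>
proof (cases "\<exists>i. hausdorff_premeasure g \<rho> (Y i) = \<infinity>")
  case True
  then obtain i where "hausdorff_premeasure g \<rho> (Y i) = \<infinity>" by blast
  then have "(\<Sum>i. hausdorff_premeasure g \<rho> (Y i)) = \<infinity>"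
    using sum_le_suminf[of "\<lambda>i. hausdorff_premeasure g \<rho> (Y i)" "{i}"] by (simp add: top_unique)
  then show ?thesis by simp
next
  case False
  show ?thesis
  proof (rule ennreal_le_epsilon)
    fix e :: real assume e: "e > 0"
    define d where "d i = e * (1/2) ^ Suc i" for i :: nat
    have d: "d i > 0" for i using e by (simp add: d_def)
    have "\<exists>(I::nat set) c r. (\<forall>j\<in>I. r j \<in> {0<..\<rho>}) \<and> Y i \<subseteq> (\<Union>j\<in>I. ball (c j) (r j)) \<and>
        (\<Sum>\<^sub>\<infinity>j\<in>I. ennreal (g (r j))) \<le> hausdorff_premeasure g \<rho> (Y i) + ennreal (d i)"
      for i :: nat
    proof -
      have "hausdorff_premeasure g \<rho> (Y i) < hausdorff_premeasure g \<rho> (Y i) + ennreal (d i)"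
        using False d[of i] by (simp add: ennreal_add_left_cancel_less less_top)
      then show ?thesis by (elim hausdorff_premeasure_lessE) (meson less_imp_le)
    qed
    then obtain I c r where
      r: "\<And>i j. j \<in> I i \<Longrightarrow> r i j \<in> {0<..\<rho>}" and
      Y: "\<And>i::nat. Y i \<subseteq> (\<Union>j\<in>(I i :: nat set). ball (c i j) (r i j))" and
      s: "\<And>i. (\<Sum>\<^sub>\<infinity>j\<in>I i. ennreal (g (r i j))) \<le> hausdorff_premeasure g \<rho> (Y i) + ennreal (d i)"
      by metis
    \<comment> \<open>Covers are indexed by sets of naturals, so the double family is transported
      along the pairing bijection.\<close>
    define R where "R = case_prod r \<circ> prod_decode"
    define C where "C = case_prod c \<circ> prod_decode"
    define J where "J = prod_encode ` Sigma UNIV I"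
    have "hausdorff_premeasure g \<rho> (\<Union>i. Y i) \<le> (\<Sum>\<^sub>\<infinity>k\<in>J. ennreal (g (R k)))"
      unfolding hausdorff_premeasure_def
    proof (rule Inf_lower, intro CollectI exI conjI)
      show "(\<Union>i. Y i) \<subseteq> (\<Union>i\<in>J. ball (C i) (R i))"
        using Y by (fastforce simp: J_def R_def C_def)
    qed (use r in \<open>auto simp: J_def R_def\<close>)
    also have "\<dots> = (\<Sum>\<^sub>\<infinity>(i,j)\<in>Sigma UNIV I. ennreal (g (r i j)))"
      unfolding J_def by (subst infsum_reindex) (auto simp: R_def o_def case_prod_unfold inj_prod_encode)
    also have "\<dots> \<le> (\<Sum>i. \<Sum>\<^sub>\<infinity>j\<in>I i. ennreal (g (r i j)))"
      using infsum_Sigma_ennreal_le[of "\<lambda>(i,j). ennreal (g (r i j))" UNIV I]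
      by (simp add: infsum_ennreal_eq_suminf)
    also have "\<dots> \<le> (\<Sum>i. hausdorff_premeasure g \<rho> (Y i) + ennreal (d i))"
      by (intro suminf_le s) auto
    also have "\<dots> = (\<Sum>i. hausdorff_premeasure g \<rho> (Y i)) + (\<Sum>i. ennreal (d i))"
      by (rule suminf_add[symmetric]) auto
    also have "(\<Sum>i. ennreal (d i)) = ennreal e"
    proof (rule suminf_ennreal_eq)
      show "d sums e" using sums_mult[OF power_half_series, of e] by (simp add: d_def[abs_def])
    qed (use d in \<open>auto intro: less_imp_le\<close>)
    finally show "hausdorff_premeasure g \<rho> (\<Union>i. Y i)
      \<le> (\<Sum>i. hausdorff_premeasure g \<rho> (Y i)) + ennreal e" .
  qed
qed

lemma hausdorff_premeasure_Un_le:
  "hausdorff_premeasure g \<rho> (A \<union> B) \<le> hausdorff_premeasure g \<rho> A + hausdorff_premeasure g \<rho> B"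
proof -
  define Y where "Y i = (if i = 0 then A else if i = 1 then B else {})" for i :: nat
  have "(\<Union>i. Y i) = A \<union> B" by (auto simp: Y_def split: if_splits)
  moreover have "(\<Sum>i. hausdorff_premeasure g \<rho> (Y i)) = (\<Sum>i\<in>{0,1}. hausdorff_premeasure g \<rho> (Y i))"
    by (rule suminf_finite) (auto simp: Y_def)
  ultimately show ?thesis using hausdorff_premeasure_UN_le[of g \<rho> Y] by (simp add: Y_def)
qed

lemma hausdorff_premeasure_finite_UN_le:
  assumes "finite F"
  shows "hausdorff_premeasure g \<rho> (\<Union>i\<in>F. Y i) \<le> (\<Sum>i\<in>F. hausdorff_premeasure g \<rho> (Y i))"
  using assms
proof induction
  case (insert i F)
  then show ?case
    using hausdorff_premeasure_Un_le[of g \<rho> "Y i" "\<Union>i\<in>F. Y i"] by (simp add: add_left_mono order_trans)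
qed simp

subsection \<open>Spacing of points where a polynomial is near an integer\<close>

text \<open>The leftmost point costs at most 1/T, and every other \<open>1 / f y\<close> is paid for
  by L times the gap to its left neighbour. The gaps are disjoint in [a, b], so their lengths add up
  to at most b - a.\<close>

lemma sum_inverse_spaced_mono:
  fixes f :: "real \<Rightarrow> real"
  assumes "finite X" and T: "T > 0" "\<And>x. x \<in> X \<Longrightarrow> T \<le> f x" and L: "L \<ge> 0"
    and "\<And>x y. x \<in> X \<Longrightarrow> y \<in> X \<Longrightarrow> x < y \<Longrightarrow> 1 / f y \<le> L * (y - x)"
    and "X \<subseteq> {a..b}" "a \<le> b"
  shows "(\<Sum>x\<in>X. 1 / f x) \<le> 1 / T + L * (b - a)"
  using assms(1,3,5-)
proof (induction X arbitrary: b rule: finite_linorder_max_induct)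
  case empty
  then show ?case using T L by simp
next
  case (insert m X)
  have m: "T \<le> f m" "a \<le> m" "m \<le> b" using insert.prems by auto
  have "(\<Sum>x\<in>X. 1 / f x) + 1 / f m \<le> 1 / T + L * (m - a)"
  proof (cases "X = {}")
    case True
    have "1 / f m \<le> 1 / T" using m T by (simp add: frac_le)
    then show ?thesis using True m L by (simp add: add_increasing2)
  next
    case False
    then have mx: "Max X \<in> X" using insert.hyps by simp
    \<comment> \<open>The interval for the remaining points ends at their maximum, which leaves the
      last gap free to pay for \<open>m\<close>.\<close>
    have "(\<Sum>x\<in>X. 1 / f x) \<le> 1 / T + L * (Max X - a)"
      by (rule insert.IH) (use insert.prems insert.hyps mx in auto)
    moreover have "1 / f m \<le> L * (m - Max X)"
      using insert.prems insert.hyps mx by auto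
    ultimately show ?thesis by (simp add: algebra_simps)
  qed
  also have "\<dots> \<le> 1 / T + L * (b - a)"
    using m L by (simp add: mult_left_mono)
  finally show ?case using insert.hyps by (subst sum.insert) auto
qed

text \<open>For increasing f the larger of the two values sits at the right end, as the one-sided
  version requires; for decreasing f the reflection at 0 reduces to that case.\<close>

lemma sum_inverse_spaced:
  fixes f :: "real \<Rightarrow> real"
  assumes X: "finite X" "X \<subseteq> {a..b}" "a \<le> b" and T: "T > 0" "\<And>x. x \<in> X \<Longrightarrow> T \<le> f x" and L: "L \<ge> 0"
    and sp: "\<And>x y. x \<in> X \<Longrightarrow> y \<in> X \<Longrightarrow> x < y \<Longrightarrow> 1 / max (f x) (f y) \<le> L * (y - x)"
    and mono: "mono_on X f \<or> antimono_on X f"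
  shows "(\<Sum>x\<in>X. 1 / f x) \<le> 1 / T + L * (b - a)"
  using mono
proof
  assume m: "mono_on X f"
  show ?thesis
  proof (rule sum_inverse_spaced_mono)
    fix x y assume "x \<in> X" "y \<in> X" "x < y"
    then show "1 / f y \<le> L * (y - x)"
      using sp[of x y] mono_onD[OF m, of x y] by (simp add: max_def split: if_splits)
  qed (use assms in auto)
next
  assume m: "antimono_on X f"
  have "(\<Sum>x\<in>uminus ` X. 1 / f (- x)) \<le> 1 / T + L * (- a - - b)"
  proof (rule sum_inverse_spaced_mono)
    fix x y assume "x \<in> uminus ` X" "y \<in> uminus ` X" "x < y"
    then show "1 / f (- y) \<le> L * (y - x)"
      using sp[of "-y" "-x"] monotone_onD[OF m, of "-y" "-x"] by (auto simp: max_def split: if_splits)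
  qed (use assms in auto)
  then show ?thesis by (simp add: sum.reindex)
qed

text \<open>The square of p has derivative 2 p p', so |p| can switch between growth and decay only
  at a root of p p'. If p p' is nonzero, it has at most 2 deg p roots, which bounds the number of
  pieces.\<close>

lemma abs_poly_piecewise_monotone:
  fixes p :: "real poly"
  obtains J :: "nat \<Rightarrow> real set"
  where "(\<Union>m\<le>2 * degree p. J m) = UNIV" "\<And>m. is_interval (J m)"
    "\<And>m. mono_on (J m) (\<lambda>x. \<bar>poly p x\<bar>) \<or> antimono_on (J m) (\<lambda>x. \<bar>poly p x\<bar>)"
proof
  define q where "q = p * pderiv p"
  define Z where "Z = {z. poly q z = 0}"
  \<comment> \<open>A point is labelled by the number of roots strictly to its left. If
    \<open>q\<close> is zero, there are infinitely many of them and \<open>card\<close> returns 0,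
    so \<open>J 0\<close> is the whole line and all other pieces are empty.\<close>
  define J where "J m = {x. card {z \<in> Z. z < x} = m}" for m
  have card: "card {z \<in> Z. z < x} \<le> 2 * degree p" for x
  proof (cases "q = 0")
    case True
    then have "{z \<in> Z. z < x} = {..<x}" by (auto simp: Z_def)
    then show ?thesis by (simp add: infinite_Iio)
  next
    case False
    have fin: "finite Z" using False poly_roots_finite by (simp add: Z_def)
    have "card {z \<in> Z. z < x} \<le> card Z" by (rule card_mono) (use fin in auto)
    also have "\<dots> \<le> degree q" using False unfolding Z_def by (rule card_poly_roots_bound)
    also have "\<dots> \<le> degree p + degree (pderiv p)" unfolding q_def by (rule degree_mult_le)
    finally show ?thesis by (simp add: degree_pderiv)
  qed
  then show "(\<Union>m\<le>2 * degree p. J m) = UNIV" by (auto simp: J_def)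
  fix m
  have cardeq: "q = 0 \<or> (\<forall>w\<in>Z. w < y \<longrightarrow> w < x)" if "x \<in> J m" "y \<in> J m" "x \<le> y" for x y
  proof (cases "q = 0")
    case False
    then have "finite Z" using poly_roots_finite by (simp add: Z_def)
    then have "{z \<in> Z. z < x} = {z \<in> Z. z < y}"
      using that by (intro card_subset_eq) (auto simp: J_def)
    then show ?thesis by blast
  qed simp
  show "is_interval (J m)"
    unfolding is_interval_1
  proof (intro ballI allI impI)
    fix x y z assume *: "x \<in> J m" "y \<in> J m" "x \<le> z \<and> z \<le> y"
    show "z \<in> J m"
    proof (cases "q = 0")
      case True
      then have "{z \<in> Z. z < x} = {..<x}" for x by (auto simp: Z_def)
      then have "card {z \<in> Z. z < x} = 0" for x by (simp add: infinite_Iio)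
      then show ?thesis using * by (simp add: J_def split: if_splits)
    next
      case False
      then have "{w \<in> Z. w < z} = {w \<in> Z. w < x}" using cardeq[of x y] * by force
      then show ?thesis using * by (simp add: J_def)
    qed
  qed
  \<comment> \<open>A root is not counted at its own position, so it can be the right endpoint of a
    piece; hence the strict \<open>z < y\<close>.\<close>
  have noroot: "q = 0 \<or> poly q z \<noteq> 0" if "x \<in> J m" "y \<in> J m" "x \<le> z" "z < y" for x y z
    using cardeq[of x y] that by (force simp: Z_def)
  have mvt: "\<exists>\<xi>>x. \<xi> < y \<and> (poly p y)\<^sup>2 - (poly p x)\<^sup>2 = (y - x) * (2 * poly q \<xi>)" if "x < y" for x y
  proof -
    have "((\<lambda>x. (poly p x)\<^sup>2) has_real_derivative 2 * poly q z) (at z)" for z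
      unfolding q_def by (auto intro!: derivative_eq_intros poly_DERIV)
    from MVT2[OF that this] show ?thesis by auto
  qed
  show "mono_on (J m) (\<lambda>x. \<bar>poly p x\<bar>) \<or> antimono_on (J m) (\<lambda>x. \<bar>poly p x\<bar>)"
  \<comment> \<open>A strict fall and a strict rise of |p| within one piece give, by the mean value
    theorem for the square, points where \<open>q\<close> is negative and positive. The root of
    \<open>q\<close> between them contradicts \<open>noroot\<close>.\<close>
  proof (rule ccontr)
    assume neg: "\<not> ?thesis"
    from neg have "\<not> mono_on (J m) (\<lambda>x. \<bar>poly p x\<bar>)" by blast
    then obtain x y where xy: "x \<in> J m" "y \<in> J m" "x \<le> y" "\<bar>poly p x\<bar> > \<bar>poly p y\<bar>"
      unfolding monotone_on_def by (meson not_le)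
    from neg have "\<not> antimono_on (J m) (\<lambda>x. \<bar>poly p x\<bar>)" by blast
    then obtain x' y' where xy': "x' \<in> J m" "y' \<in> J m" "x' \<le> y'" "\<bar>poly p x'\<bar> < \<bar>poly p y'\<bar>"
      unfolding monotone_on_def by (meson not_le)
    have lt: "x < y" "x' < y'" using xy xy' by (auto simp: less_le)
    obtain \<xi> where \<xi>: "x < \<xi>" "\<xi> < y" "(poly p y)\<^sup>2 - (poly p x)\<^sup>2 = (y - x) * (2 * poly q \<xi>)"
      using mvt lt by blast
    obtain \<xi>' where \<xi>': "x' < \<xi>'" "\<xi>' < y'" "(poly p y')\<^sup>2 - (poly p x')\<^sup>2 = (y' - x') * (2 * poly q \<xi>')"
      using mvt lt by blast
    have "(poly p y)\<^sup>2 - (poly p x)\<^sup>2 < 0"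
      using xy power_strict_mono[of "\<bar>poly p y\<bar>" "\<bar>poly p x\<bar>" 2] by simp
    then have neg: "poly q \<xi> < 0" using \<xi> lt by (simp add: mult_less_0_iff)
    have "(poly p y')\<^sup>2 - (poly p x')\<^sup>2 > 0"
      using xy' power_strict_mono[of "\<bar>poly p x'\<bar>" "\<bar>poly p y'\<bar>" 2] by simp
    then have pos: "poly q \<xi>' > 0" using \<xi>' lt by (simp add: zero_less_mult_iff)
    have "\<exists>z. min \<xi> \<xi>' \<le> z \<and> z \<le> max \<xi> \<xi>' \<and> poly q z = 0"
    proof (cases "\<xi> < \<xi>'")
      case True
      then show ?thesis using poly_IVT_pos[OF True neg pos] True by (auto simp: min_def max_def intro: less_imp_le)
    next
      case False
      then have "\<xi>' < \<xi>" using neg pos by (cases "\<xi> = \<xi>'") auto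
      then show ?thesis using poly_IVT_neg[OF _ pos neg] by (auto simp: min_def max_def intro: less_imp_le)
    qed
    then obtain z where z: "min \<xi> \<xi>' \<le> z" "z \<le> max \<xi> \<xi>'" "poly q z = 0" by blast
    have "min x x' \<in> J m" "max y y' \<in> J m" using xy xy' by (auto simp: min_def max_def)
    moreover have "min x x' \<le> z" "z < max y y'" using z \<xi> \<xi>' by (auto simp: min_def max_def split: if_splits)
    ultimately have "q = 0" using noroot z by blast
    then show False using neg by simp
  qed
qed

text \<open>Points of \<open>Y\<close> that share an integer lie in one ball of radius 5 \<delta> /
  |p'(x)| about a representative x, because \<open>4 * K * \<delta> \<le> T\<^sup>2\<close> keeps
  |p'| from varying by more than T/2 among them. The spacing estimate then bounds the sum of 1 /
  |p'(x)| over the representatives.\<close>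

lemma hausdorff_premeasure_near_integer_level_le:
  fixes p :: "real poly" and M T K B \<delta> \<rho> :: real and J
  defines "Y \<equiv> {x \<in> J. \<bar>x\<bar> \<le> M \<and> (\<exists>b::int. \<bar>poly p x + of_int b\<bar> \<le> \<delta>) \<and> T \<le> \<bar>poly (pderiv p) x\<bar>}"
  assumes J: "is_interval J"
    and mono: "mono_on J (\<lambda>x. \<bar>poly (pderiv p) x\<bar>) \<or> antimono_on J (\<lambda>x. \<bar>poly (pderiv p) x\<bar>)"
    and M: "M \<ge> 0" and T: "T > 0" and \<delta>: "0 < \<delta>" "\<delta> \<le> 1/4" and \<rho>: "5 * \<delta> / T \<le> \<rho>"
    and K: "\<And>x. \<bar>x\<bar> \<le> M \<Longrightarrow> \<bar>poly (pderiv (pderiv p)) x\<bar> \<le> K" "4 * K * \<delta> \<le> T\<^sup>2"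
    and B: "\<And>x. \<bar>x\<bar> \<le> M \<Longrightarrow> \<bar>poly (pderiv p) x\<bar> \<le> B"
    and g: "\<And>c r. c \<ge> 1 \<Longrightarrow> r > 0 \<Longrightarrow> g (c * r) \<le> c * g r" "\<And>r. r > 0 \<Longrightarrow> g r > 0"
  shows "hausdorff_premeasure g \<rho> Y \<le> ennreal (5 * B * g (\<delta> / B) * (1 / T + 4 * M))"
proof (cases "Y = {}")
  case True
  then show ?thesis by simp
next
  case False
  define f where "f x = \<bar>poly (pderiv p) x\<bar>" for x
  have YD: "x \<in> J" "\<bar>x\<bar> \<le> M" "T \<le> f x" if "x \<in> Y" for x
    using that by (auto simp: Y_def f_def)
  have Bpos: "B > 0" using False YD B T by (force simp: f_def)
  have "\<forall>x\<in>Y. \<exists>b::int. \<bar>poly p x + of_int b\<bar> \<le> \<delta>" by (auto simp: Y_def)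
  then obtain \<beta> :: "real \<Rightarrow> int" where \<beta>: "\<And>x. x \<in> Y \<Longrightarrow> \<bar>poly p x + of_int (\<beta> x)\<bar> \<le> \<delta>" by metis
  \<comment> \<open>The intermediate point need not lie in \<open>Y\<close>, but it lies in the
    interval \<open>J\<close>, where monotonicity confines \<open>f\<close> to the range between its
    values at x and y.\<close>
  have mvt: "\<exists>\<xi>. \<bar>poly p x - poly p y\<bar> = \<bar>x - y\<bar> * f \<xi> \<and> min (f x) (f y) \<le> f \<xi> \<and> f \<xi> \<le> max (f x) (f y)"
    if "x \<in> Y" "y \<in> Y" for x y
  proof -
    have *: "\<exists>\<xi>. \<bar>poly p x - poly p y\<bar> = \<bar>x - y\<bar> * f \<xi> \<and> min (f x) (f y) \<le> f \<xi> \<and> f \<xi> \<le> max (f x) (f y)"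
      if "x \<in> Y" "y \<in> Y" "x < y" for x y
    proof -
      obtain \<xi> where \<xi>: "x < \<xi>" "\<xi> < y" "poly p y - poly p x = (y - x) * poly (pderiv p) \<xi>"
        using poly_MVT[OF \<open>x < y\<close>] by blast
      then have "\<xi> \<in> J" using J YD that unfolding is_interval_1 by (meson less_imp_le)
      then have "f x \<le> f \<xi> \<and> f \<xi> \<le> f y \<or> f y \<le> f \<xi> \<and> f \<xi> \<le> f x"
        using mono YD(1)[OF that(1)] YD(1)[OF that(2)] \<xi>(1,2) unfolding f_def monotone_on_def by force
      then have "min (f x) (f y) \<le> f \<xi> \<and> f \<xi> \<le> max (f x) (f y)" by linarith
      moreover have "\<bar>poly p x - poly p y\<bar> = \<bar>x - y\<bar> * f \<xi>"
        using \<xi>(3) by (metis abs_minus_commute abs_mult f_def)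
      ultimately show ?thesis by blast
    qed
    consider "x < y" | "y < x" | "x = y" by linarith
    then show ?thesis
    proof cases
      case 2
      then show ?thesis using *[of y x] that by (simp add: abs_minus_commute min.commute max.commute)
    qed (use * that in auto)
  qed
  \<comment> \<open>\<open>X\<close> holds one representative for each integer that occurs; p is
    bounded on [-M, M], so these are finitely many.\<close>
  define \<sigma> where "\<sigma> = inv_into Y \<beta>"
  define X where "X = \<sigma> ` \<beta> ` Y"
  have XY: "X \<subseteq> Y" by (auto simp: X_def \<sigma>_def inv_into_into)
  have finX: "finite X"
  proof -
    have "compact (poly p ` {-M..M})"
      by (intro compact_continuous_image continuous_intros) auto
    then obtain N where N: "\<forall>x\<in>{-M..M}. \<bar>poly p x\<bar> \<le> N"
      using compact_imp_bounded[of "poly p ` {-M..M}"] by (auto simp: bounded_iff)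
    have "\<beta> ` Y \<subseteq> {- \<lceil>N + 1\<rceil>..\<lceil>N + 1\<rceil>}"
    proof
      fix b assume "b \<in> \<beta> ` Y"
      then obtain x where x: "x \<in> Y" "b = \<beta> x" by blast
      have "\<bar>poly p x\<bar> \<le> N" using N YD[OF x(1)] by (auto simp: abs_le_iff)
      then have "\<bar>of_int b\<bar> \<le> N + 1" using \<beta>[OF x(1)] x \<delta> by linarith
      then show "b \<in> {- \<lceil>N + 1\<rceil>..\<lceil>N + 1\<rceil>}" by (simp; linarith)
    qed
    then show ?thesis unfolding X_def using finite_subset by blast
  qed
  \<comment> \<open>Distinct integers are at least 1 apart and \<delta> is at most 1/4, so the
    values of p differ by at least 1/2. Hence the spacing constant 2.\<close>
  have sep: "1 / max (f x) (f y) \<le> 2 * (y - x)" if "x \<in> X" "y \<in> X" "x < y" for x y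
  proof -
    have "\<beta> x \<noteq> \<beta> y" using that by (auto simp: X_def \<sigma>_def f_inv_into_f)
    then have "1 \<le> \<bar>real_of_int (\<beta> x) - real_of_int (\<beta> y)\<bar>" by linarith
    moreover have xy: "x \<in> Y" "y \<in> Y" using that XY by auto
    ultimately have *: "1/2 \<le> \<bar>poly p x - poly p y\<bar>"
      using \<beta>[OF xy(1)] \<beta>[OF xy(2)] \<delta> by linarith
    obtain \<xi> where \<xi>: "\<bar>poly p x - poly p y\<bar> = \<bar>x - y\<bar> * f \<xi>" "f \<xi> \<le> max (f x) (f y)"
      using mvt[OF xy] by blast
    have "\<bar>x - y\<bar> * f \<xi> \<le> \<bar>x - y\<bar> * max (f x) (f y)"
      using \<xi>(2) by (intro mult_left_mono) auto
    then have "1/2 \<le> \<bar>x - y\<bar> * max (f x) (f y)" using * \<xi>(1) by linarith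
    then have "1/2 \<le> (y - x) * max (f x) (f y)" using that by simp
    moreover have "max (f x) (f y) > 0" using YD[OF xy(1)] T by auto
    ultimately have "1 \<le> 2 * (y - x) * max (f x) (f y)" by linarith
    with \<open>max (f x) (f y) > 0\<close> show ?thesis by (simp only: pos_divide_le_eq)
  qed
  have sum: "(\<Sum>x\<in>X. 1 / f x) \<le> 1 / T + 2 * (M - - M)"
  proof (rule sum_inverse_spaced[OF finX _ _ T(1)])
    show "X \<subseteq> {- M..M}" using XY YD(2) by fastforce
    have "X \<subseteq> J" using XY YD by auto
    then show "mono_on X f \<or> antimono_on X f"
      using mono unfolding f_def monotone_on_def by blast
  qed (use M XY YD sep in auto)
  \<comment> \<open>The smaller slope \<mu> is at least half of \<open>f x\<close>, so x and y are
    at most 4 \<delta> / \<open>f x\<close> apart; the 5 makes room for an open ball.\<close>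
  have close: "y \<in> ball x (5 * \<delta> / f x)" if xy: "x \<in> Y" "y \<in> Y" "\<beta> x = \<beta> y" for x y
  proof -
    define \<mu> where "\<mu> = min (f x) (f y)"
    have \<mu>: "\<mu> \<ge> T" using YD xy by (simp add: \<mu>_def)
    have "\<bar>poly p x - poly p y\<bar> \<le> 2 * \<delta>" using \<beta>[OF xy(1)] \<beta>[OF xy(2)] xy(3) by linarith
    moreover obtain \<xi> where "\<bar>poly p x - poly p y\<bar> = \<bar>x - y\<bar> * f \<xi>" "\<mu> \<le> f \<xi>"
      using mvt[OF xy(1,2)] \<mu>_def by blast
    ultimately have 1: "\<bar>x - y\<bar> * \<mu> \<le> 2 * \<delta>"
      using mult_left_mono[of \<mu> "f \<xi>" "\<bar>x - y\<bar>"] by auto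
    have K0: "K \<ge> 0" using K(1)[of x] YD[OF xy(1)] by linarith
    have "\<bar>f x - f y\<bar> \<le> K * \<bar>x - y\<bar>"
    proof -
      have "norm (poly (pderiv p) x - poly (pderiv p) y) \<le> K * norm (x - y)"
      proof (rule field_differentiable_bound)
        show "convex {-M..M}" by simp
        fix z assume "z \<in> {-M..M}"
        then show "norm (poly (pderiv (pderiv p)) z) \<le> K" using K(1)[of z] by auto
        show "(poly (pderiv p) has_field_derivative poly (pderiv (pderiv p)) z) (at z within {-M..M})"
          using poly_DERIV has_field_derivative_at_within by blast
      qed (use YD[OF xy(1)] YD[OF xy(2)] in auto)
      then show ?thesis by (simp add: f_def)
    qed
    also have "K * \<bar>x - y\<bar> \<le> T / 2"
    proof -
      have "K * \<bar>x - y\<bar> * T \<le> K * (\<bar>x - y\<bar> * \<mu>)"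
        using \<mu> K0 by (simp add: mult_left_mono mult.assoc)
      also have "\<dots> \<le> K * (2 * \<delta>)" using 1 K0 by (rule mult_left_mono)
      also have "\<dots> \<le> T / 2 * T" using K(2) by (simp add: power2_eq_square)
      finally show ?thesis using T by (simp only: mult_le_cancel_right_pos)
    qed
    finally have "f x / 2 \<le> \<mu>" using YD[OF xy(1)] by (auto simp: \<mu>_def min_def)
    then have "\<bar>x - y\<bar> * (f x / 2) \<le> 2 * \<delta>"
      using 1 mult_left_mono[of "f x / 2" \<mu> "\<bar>x - y\<bar>"] by linarith
    then have "\<bar>x - y\<bar> * f x < 5 * \<delta>" using \<delta> by linarith
    then show ?thesis using YD[OF xy(1)] T by (simp add: dist_real_def less_divide_eq)
  qed
  have "Y \<subseteq> (\<Union>x\<in>X. ball x (5 * \<delta> / f x))"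
  proof
    fix y assume y: "y \<in> Y"
    define x where "x = \<sigma> (\<beta> y)"
    have "\<beta> x = \<beta> y" "x \<in> X" using y by (auto simp: x_def X_def \<sigma>_def f_inv_into_f)
    then show "y \<in> (\<Union>x\<in>X. ball x (5 * \<delta> / f x))" using close[of x y] XY y by blast
  qed
  then have "hausdorff_premeasure g \<rho> Y \<le> hausdorff_premeasure g \<rho> (\<Union>x\<in>X. ball x (5 * \<delta> / f x))"
    by (rule hausdorff_premeasure_mono)
  also have "\<dots> \<le> (\<Sum>x\<in>X. hausdorff_premeasure g \<rho> (ball x (5 * \<delta> / f x)))"
    by (rule hausdorff_premeasure_finite_UN_le[OF finX])
  also have "\<dots> \<le> (\<Sum>x\<in>X. ennreal (5 * B * g (\<delta> / B) * (1 / f x)))"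
  proof (rule sum_mono)
    fix x assume "x \<in> X"
    then have x: "T \<le> f x" "\<bar>x\<bar> \<le> M" using XY YD by auto
    have fx: "f x > 0" using x T by linarith
    have "5 * \<delta> / f x \<le> 5 * \<delta> / T" using x T \<delta> by (simp add: frac_le)
    then have "hausdorff_premeasure g \<rho> (ball x (5 * \<delta> / f x)) \<le> ennreal (g (5 * \<delta> / f x))"
      using \<rho> \<delta> fx by (intro hausdorff_premeasure_ball_le) auto
    also have "g (5 * \<delta> / f x) \<le> 5 * B * g (\<delta> / B) * (1 / f x)"
    proof -
      \<comment> \<open>The radius is written as a multiple, by a factor at least 1, of the fixed
        scale \<delta>/B, so that all balls are compared with the same value of g.\<close>
      have "5 * B / f x \<ge> 1" using B[OF x(2)] fx by (simp add: f_def le_divide_eq)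
      then have "g (5 * B / f x * (\<delta> / B)) \<le> 5 * B / f x * g (\<delta> / B)"
        using Bpos \<delta> by (intro g) auto
      moreover have "5 * B / f x * (\<delta> / B) = 5 * \<delta> / f x" using Bpos by simp
      ultimately show ?thesis by simp
    qed
    finally show "hausdorff_premeasure g \<rho> (ball x (5 * \<delta> / f x)) \<le> ennreal (5 * B * g (\<delta> / B) * (1 / f x))"
      by (simp add: ennreal_leI)
  qed
  also have "\<dots> = ennreal (5 * B * g (\<delta> / B) * (\<Sum>x\<in>X. 1 / f x))"
    using XY YD(3) T Bpos \<delta> g(2)[of "\<delta> / B"] unfolding sum_distrib_left
    by (intro sum_ennreal mult_nonneg_nonneg) (auto simp: f_def)
  also have "\<dots> \<le> ennreal (5 * B * g (\<delta> / B) * (1 / T + 4 * M))"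
    using sum Bpos \<delta> g(2)[of "\<delta> / B"] by (intro ennreal_leI mult_left_mono) auto
  finally show ?thesis .
qed

lemma hausdorff_premeasure_near_integer_le:
  fixes p :: "real poly" and M T K B \<delta> \<rho> :: real
  assumes deg: "degree p \<le> n"
    and M: "M \<ge> 0" and T: "T > 0" and \<delta>: "0 < \<delta>" "\<delta> \<le> 1/4" and \<rho>: "5 * \<delta> / T \<le> \<rho>"
    and K: "\<And>x. \<bar>x\<bar> \<le> M \<Longrightarrow> \<bar>poly (pderiv (pderiv p)) x\<bar> \<le> K" "4 * K * \<delta> \<le> T\<^sup>2"
    and B: "\<And>x. \<bar>x\<bar> \<le> M \<Longrightarrow> \<bar>poly (pderiv p) x\<bar> \<le> B" "B > 0"
    and g: "\<And>c r. c \<ge> 1 \<Longrightarrow> r > 0 \<Longrightarrow> g (c * r) \<le> c * g r" "\<And>r. r > 0 \<Longrightarrow> g r > 0"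
  shows "hausdorff_premeasure g \<rho> {x. \<bar>x\<bar> \<le> M \<and> (\<exists>b::int. \<bar>poly p x + of_int b\<bar> \<le> \<delta>) \<and> T \<le> \<bar>poly (pderiv p) x\<bar>}
    \<le> ennreal ((2 * real n + 1) * (5 * B * g (\<delta> / B) * (1 / T + 4 * M)))"
proof -
  obtain J where J: "(\<Union>m\<le>2 * degree (pderiv p). J m) = UNIV" "\<And>m. is_interval (J m)"
    "\<And>m. mono_on (J m) (\<lambda>x. \<bar>poly (pderiv p) x\<bar>) \<or> antimono_on (J m) (\<lambda>x. \<bar>poly (pderiv p) x\<bar>)"
    using abs_poly_piecewise_monotone[of "pderiv p"] by blast
  define c where "c = 5 * B * g (\<delta> / B) * (1 / T + 4 * M)"
  have c: "c \<ge> 0" unfolding c_def using B(2) g(2)[of "\<delta> / B"] \<delta> M T by (intro mult_nonneg_nonneg) auto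
  define Y where "Y m = {x \<in> J m. \<bar>x\<bar> \<le> M \<and> (\<exists>b::int. \<bar>poly p x + of_int b\<bar> \<le> \<delta>) \<and> T \<le> \<bar>poly (pderiv p) x\<bar>}" for m
  have "{x. \<bar>x\<bar> \<le> M \<and> (\<exists>b::int. \<bar>poly p x + of_int b\<bar> \<le> \<delta>) \<and> T \<le> \<bar>poly (pderiv p) x\<bar>}
      \<subseteq> (\<Union>m\<le>2 * degree (pderiv p). Y m)"
  proof
    fix x assume x: "x \<in> {x. \<bar>x\<bar> \<le> M \<and> (\<exists>b::int. \<bar>poly p x + of_int b\<bar> \<le> \<delta>) \<and> T \<le> \<bar>poly (pderiv p) x\<bar>}"
    have "x \<in> (\<Union>m\<le>2 * degree (pderiv p). J m)" by (simp add: J(1))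
    then show "x \<in> (\<Union>m\<le>2 * degree (pderiv p). Y m)" using x by (auto simp: Y_def)
  qed
  then have "hausdorff_premeasure g \<rho> {x. \<bar>x\<bar> \<le> M \<and> (\<exists>b::int. \<bar>poly p x + of_int b\<bar> \<le> \<delta>) \<and> T \<le> \<bar>poly (pderiv p) x\<bar>}
      \<le> hausdorff_premeasure g \<rho> (\<Union>m\<le>2 * degree (pderiv p). Y m)"
    by (rule hausdorff_premeasure_mono)
  also have "\<dots> \<le> (\<Sum>m\<le>2 * degree (pderiv p). hausdorff_premeasure g \<rho> (Y m))"
    by (rule hausdorff_premeasure_finite_UN_le) simp
  also have "\<dots> \<le> (\<Sum>m\<le>2 * degree (pderiv p). ennreal c)"
    unfolding Y_def c_def
    by (intro sum_mono hausdorff_premeasure_near_integer_level_le[where K = K] J(2,3) M T \<delta> \<rho> K B g)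
  also have "\<dots> = ennreal ((2 * real (degree (pderiv p)) + 1) * c)"
    by (subst sum_ennreal) (use c in \<open>simp_all add: add.commute\<close>)
  also have "\<dots> \<le> ennreal ((2 * real n + 1) * c)"
    using c deg by (intro ennreal_leI mult_right_mono) (auto simp: degree_pderiv)
  finally show ?thesis by (simp only: c_def)
qed

subsection \<open>Height, Mahler measure and discriminant\<close>

lemma abs_coeff_le_height: "\<bar>Polynomial.coeff P i\<bar> \<le> height P"
proof (cases "i \<le> degree P \<and> P \<noteq> 0")
  case True
  then have "Polynomial.coeff P i \<in> set (coeffs P)" by (simp add: coeff_in_coeffs)
  then have "nat \<bar>Polynomial.coeff P i\<bar> \<le> max_list (map (nat \<circ> abs) (coeffs P))" by (intro max_list) auto
  then show ?thesis by linarith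
next
  case False
  then show ?thesis by (auto simp: coeff_eq_0)
qed

lemma height_leI:
  assumes "\<And>i. i \<le> degree P \<Longrightarrow> \<bar>Polynomial.coeff P i\<bar> \<le> N" "N \<ge> 0"
  shows "height P \<le> N"
proof (cases "P = 0")
  case False
  then have "map (nat \<circ> abs) (coeffs P) \<noteq> []" by simp
  then have "max_list (map (nat \<circ> abs) (coeffs P)) \<in> set (map (nat \<circ> abs) (coeffs P))"
    by (rule max_list_mem)
  then obtain a where "a \<in> set (coeffs P)" "max_list (map (nat \<circ> abs) (coeffs P)) = nat \<bar>a\<bar>"
    by auto
  moreover from this(1) False obtain i where "i \<le> degree P" "a = Polynomial.coeff P i"
    by (metis in_set_conv_nth coeffs_nth length_coeffs less_Suc_eq_le Suc_eq_plus1)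
  ultimately show ?thesis using assms by simp
qed (use assms in simp)

text \<open>Landau's inequality bounds the Mahler measure by the Euclidean norm of at most d + 1
  coefficients; the resulting factor sqrt(d + 1) is relaxed to d + 1.\<close>

lemma mahler_measure_le_height: "mahler_measure P \<le> (real (degree P) + 1) * real_of_int (height P)"
proof -
  have len: "length (coeffs P) \<le> degree P + 1" by (simp add: length_coeffs coeffs_def)
  have sl: "(\<Sum>a\<leftarrow>xs. a * a) \<le> int (length xs) * c" if "\<And>a. a \<in> set xs \<Longrightarrow> a * a \<le> c" for xs and c :: int
    using that by (induction xs) (fastforce simp: algebra_simps)+
  have "(\<Sum>a\<leftarrow>coeffs P. a * a) \<le> int (length (coeffs P)) * (height P * height P)"
  proof (rule sl)
    fix a assume "a \<in> set (coeffs P)"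
    then obtain i where "a = Polynomial.coeff P i" by (auto simp: coeffs_def split: if_splits)
    then have "\<bar>a\<bar> \<le> height P" using abs_coeff_le_height by blast
    then show "a * a \<le> height P * height P" using mult_mono[of "\<bar>a\<bar>" "height P" "\<bar>a\<bar>" "height P"] by simp
  qed
  also have "\<dots> \<le> (int (degree P) + 1) * (height P * height P)"
    using len by (intro mult_right_mono) auto
  also have "\<dots> \<le> ((int (degree P) + 1) * height P)\<^sup>2"
    by (simp add: power2_eq_square mult_le_cancel_right algebra_simps)
  finally have "real_of_int (\<Sum>a\<leftarrow>coeffs P. a * a) \<le> ((real (degree P) + 1) * real_of_int (height P))\<^sup>2"
    by (metis (mono_tags, lifting) of_int_le_iff of_int_power of_int_mult of_int_add of_int_1 of_int_of_nat_eq)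
  then have "sqrt (real_of_int (\<Sum>a\<leftarrow>coeffs P. a * a)) \<le> (real (degree P) + 1) * real_of_int (height P)"
    by (intro real_le_lsqrt) auto
  then show ?thesis using Landau_inequality_mahler_measure[of P] by linarith
qed

section \<open>The discriminant and the root nearest to a point\<close>

lemma prod_pairs_square:
  fixes f :: "nat \<Rightarrow> nat \<Rightarrow> 'a :: comm_monoid_mult"
  assumes "\<And>i j. f i j = f j i"
  shows "(\<Prod>j<d. \<Prod>i<j. f i j ^ 2) = (\<Prod>i<d. \<Prod>j\<in>{..<d} - {i}. f i j)"
proof (induction d)
  case (Suc d)
  have *: "{..<Suc d} - {i} = insert d ({..<d} - {i})" if "i < d" for i using that by auto
  have "(\<Prod>i<Suc d. \<Prod>j\<in>{..<Suc d} - {i}. f i j)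
      = (\<Prod>i<d. f i d * (\<Prod>j\<in>{..<d} - {i}. f i j)) * (\<Prod>j<d. f d j)"
  proof -
    have "(\<Prod>i<d. \<Prod>j\<in>{..<Suc d} - {i}. f i j) = (\<Prod>i<d. f i d * (\<Prod>j\<in>{..<d} - {i}. f i j))"
      by (intro prod.cong) (auto simp: *)
    moreover have "{..<Suc d} - {d} = {..<d}" by auto
    ultimately show ?thesis by (simp add: mult.commute)
  qed
  also have "\<dots> = (\<Prod>i<d. \<Prod>j\<in>{..<d} - {i}. f i j) * (\<Prod>i<d. f i d ^ 2)"
    using assms[of d] by (simp add: prod.distrib power2_eq_square mult_ac)
  finally show ?case using Suc by simp
qed simp

text \<open>Nearness gives |\<alpha> i - \<alpha> k| \<le> 2 |x - \<alpha> i|, while any other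
  difference is at most twice the product of the two maxima of 1 and the modulus. Each pair counts
  twice: pairs with k yield the square of the product over \<open>I\<close>, and in the others each
  of the e + 1 remaining roots occurs 2e times. The exponent of 2 is 2(e + 1) + e(e + 1).\<close>

lemma prod_root_differences_le:
  fixes \<alpha> :: "nat \<Rightarrow> complex" and x :: complex and e k :: nat
  defines "I \<equiv> {..<e + 2} - {k}"
  assumes k: "k < e + 2" and near: "\<And>i. i < e + 2 \<Longrightarrow> cmod (x - \<alpha> k) \<le> cmod (x - \<alpha> i)"
  shows "(\<Prod>j<e + 2. \<Prod>i<j. cmod (\<alpha> i - \<alpha> j) ^ 2)
    \<le> 2 ^ ((e + 1) * (e + 2)) * (\<Prod>i\<in>I. cmod (x - \<alpha> i)) ^ 2 * (\<Prod>i<e + 2. max 1 (cmod (\<alpha> i))) ^ (2 * e)"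
proof -
  define f where "f i j = cmod (\<alpha> i - \<alpha> j)" for i j
  define m where "m i = max 1 (cmod (\<alpha> i))" for i
  define E where "E = (\<Prod>i\<in>I. cmod (x - \<alpha> i))"
  define W where "W = prod m I"
  have m: "m i \<ge> 1" for i by (simp add: m_def)
  have W: "W \<ge> 1" unfolding W_def using m by (intro prod_ge_1) auto
  have E: "E \<ge> 0" unfolding E_def by (intro prod_nonneg) auto
  have cI: "finite I" "card I = e + 1" using k by (auto simp: I_def)
  have split: "{..<e + 2} = insert k I" "k \<notin> I" using k by (auto simp: I_def)
  have f0: "f i k \<le> 2 * cmod (x - \<alpha> i)" if "i \<in> I" for i
    using near[of i] that norm_triangle_ineq4[of "x - \<alpha> k" "x - \<alpha> i"] by (auto simp: I_def f_def)
  have f1: "f i j \<le> 2 * (m i * m j)" for i j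
  proof -
    have "f i j \<le> cmod (\<alpha> i) + cmod (\<alpha> j)" unfolding f_def by (rule norm_triangle_ineq4)
    also have "\<dots> \<le> m i * m j + m i * m j"
      using mult_mono[of "m i" "m i" 1 "m j"] mult_mono[of 1 "m i" "m j" "m j"] m[of i] m[of j]
      by (intro add_mono) (auto simp: m_def)
    finally show ?thesis by simp
  qed
  \<comment> \<open>With ordered pairs, the row of k can be split off, and then the entry of k in
    every other row.\<close>
  have "(\<Prod>j<e + 2. \<Prod>i<j. f i j ^ 2) = (\<Prod>i<e + 2. \<Prod>j\<in>{..<e + 2} - {i}. f i j)"
    by (rule prod_pairs_square) (simp add: f_def norm_minus_commute)
  also have "\<dots> = (\<Prod>j\<in>I. f k j) * (\<Prod>i\<in>I. \<Prod>j\<in>{..<e + 2} - {i}. f i j)"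
    using split cI by (simp add: I_def[symmetric] del: add_2_eq_Suc')
  also have "\<dots> \<le> (2 ^ (e + 1) * E) * (\<Prod>i\<in>I. 2 * cmod (x - \<alpha> i) * (2 ^ e * m i ^ e * (W / m i)))"
  proof (intro mult_mono prod_nonneg)
    have "(\<Prod>j\<in>I. f k j) \<le> (\<Prod>j\<in>I. 2 * cmod (x - \<alpha> j))"
      using f0 by (intro prod_mono) (simp add: f_def norm_minus_commute)
    then show "(\<Prod>j\<in>I. f k j) \<le> 2 ^ (e + 1) * E"
      by (simp add: prod.distrib E_def cI)
    show "(\<Prod>i\<in>I. \<Prod>j\<in>{..<e + 2} - {i}. f i j)
        \<le> (\<Prod>i\<in>I. 2 * cmod (x - \<alpha> i) * (2 ^ e * m i ^ e * (W / m i)))"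
    proof (intro prod_mono conjI prod_nonneg)
      fix i assume i: "i \<in> I"
      have "{..<e + 2} - {i} = insert k (I - {i})" using i split by auto
      then have "(\<Prod>j\<in>{..<e + 2} - {i}. f i j) = f i k * (\<Prod>j\<in>I - {i}. f i j)"
        using cI split by simp
      also have "\<dots> \<le> 2 * cmod (x - \<alpha> i) * (\<Prod>j\<in>I - {i}. 2 * (m i * m j))"
        using f0[OF i] f1 by (intro mult_mono prod_mono conjI prod_nonneg) (auto simp: f_def)
      also have "(\<Prod>j\<in>I - {i}. 2 * (m i * m j)) = 2 ^ e * m i ^ e * prod m (I - {i})"
        using cI i by (simp add: prod.distrib)
      also have "prod m (I - {i}) = W / m i"
        using prod.remove[OF cI(1) i, of m] m[of i] by (simp add: W_def)
      finally show "(\<Prod>j\<in>{..<e + 2} - {i}. f i j) \<le> 2 * cmod (x - \<alpha> i) * (2 ^ e * m i ^ e * (W / m i))" .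
    qed (auto simp: f_def)
  qed (use E in \<open>auto simp: f_def\<close>)
  also have "(\<Prod>i\<in>I. 2 * cmod (x - \<alpha> i) * (2 ^ e * m i ^ e * (W / m i)))
      = 2 ^ (e + 1) * E * ((2 ^ e) ^ (e + 1) * W ^ e * (W ^ (e + 1) / W))"
    by (simp add: prod.distrib prod_dividef cI E_def W_def prod_power_distrib)
  also have "(2 ^ (e + 1) * E) * (2 ^ (e + 1) * E * ((2 ^ e) ^ (e + 1) * W ^ e * (W ^ (e + 1) / W)))
      = 2 ^ ((e + 1) * (e + 2)) * E ^ 2 * W ^ (2 * e)"
  proof -
    have "(2::real) ^ ((e + 1) * (e + 2)) = 2 ^ (e + 1) * 2 ^ (e + 1) * (2 ^ e) ^ (e + 1)"
      by (simp add: power_add[symmetric] power_mult[symmetric] algebra_simps del: power_Suc)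
    moreover have "W ^ (2 * e) = W ^ e * (W ^ (e + 1) / W)" using W by (simp add: power_add mult_2)
    ultimately show ?thesis by (simp add: power2_eq_square mult_ac)
  qed
  also have "\<dots> \<le> 2 ^ ((e + 1) * (e + 2)) * E ^ 2 * prod m {..<e + 2} ^ (2 * e)"
  proof (intro mult_left_mono power_mono)
    show "W \<le> prod m {..<e + 2}"
      using W m[of k] mult_right_mono[of 1 "m k" W] by (simp add: split cI W_def del: add_2_eq_Suc')
  qed (use W in auto)
  finally show ?thesis by (simp add: f_def m_def E_def)
qed

lemma poly_of_int_poly_of_real: "poly (of_int_poly P) (complex_of_real x) = of_real (poly (of_int_poly P) x)"
  by (induction P) (auto simp: map_poly_pCons)

text \<open>
  Here \<open>w\<close> is the distance from \<open>x\<close> to the nearest root and \<open>u\<close> is the modulus at \<open>x\<close> of the cofactor of that root.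
\<close>
lemma discriminant_le_of_nearest_root:
  fixes P :: "int poly" and x M :: real
  assumes deg: "degree P = e + 2" and x: "\<bar>x\<bar> \<le> M"
  obtains u w where "u \<ge> 0" "w \<ge> 0"
    "cmod (discriminant P) \<le> 2 ^ ((e + 1) * (e + 2)) * u ^ 2 * mahler_measure P ^ (2 * e)"
    "\<bar>poly (of_int_poly P) x\<bar> = w * u"
    "u \<le> \<bar>poly (pderiv (of_int_poly P)) x\<bar> + w * ((real e + 2) * (1 + M) ^ (e + 2) * mahler_measure P)"
proof -
  define p where "p = (of_int_poly P :: complex poly)"
  define z where "z = complex_of_real x"
  define a where "a = complex_of_int (lead_coeff P)"
  define \<alpha> where "\<alpha> i = complex_roots_int P ! i" for i
  define m where "m i = max 1 (cmod (\<alpha> i))" for i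
  have len: "length (complex_roots_int P) = e + 2" using complex_roots_int(2)[of P] deg by simp
  have p: "p = Polynomial.smult a (\<Prod>i<e + 2. [:- \<alpha> i, 1:])"
    unfolding p_def complex_roots_int(1)[symmetric] a_def \<alpha>_def
    by (simp add: prod.list_conv_set_nth len atLeast0LessThan)
  have mm: "mahler_measure P = cmod a * prod m {..<e + 2}"
    using len unfolding mahler_measure_def mahler_measure_poly_def complex_roots_int_def[symmetric]
    by (simp add: prod.list_conv_set_nth a_def m_def[abs_def] \<alpha>_def atLeast0LessThan)
  obtain k where k: "k < e + 2" "\<And>i. i < e + 2 \<Longrightarrow> cmod (z - \<alpha> k) \<le> cmod (z - \<alpha> i)"
    using ex_min_if_finite[of "(\<lambda>i. cmod (z - \<alpha> i)) ` {..<e + 2}"]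
    by (auto simp: not_less lessThan_empty_iff)
  define I where "I = {..<e + 2} - {k}"
  have cI: "finite I" "card I = e + 1" using k by (auto simp: I_def)
  have split: "{..<e + 2} = insert k I" "k \<notin> I" using k by (auto simp: I_def)
  define E where "E = (\<Prod>i\<in>I. cmod (z - \<alpha> i))"
  \<comment> \<open>\<open>S\<close> is the cofactor of the nearest root and \<open>u\<close> its
    modulus at z. As p' = S + (X - \<alpha> k) S', a bound on S' lets a large \<open>u\<close> force
    a large derivative.\<close>
  define S where "S = Polynomial.smult a (\<Prod>i\<in>I. [:- \<alpha> i, 1:])"
  have pS: "p = [:- \<alpha> k, 1:] * S"
    unfolding p S_def split(1) using cI split(2) by simp
  define u where "u = cmod a * E"
  define w where "w = cmod (z - \<alpha> k)"
  have S: "cmod (poly S z) = u"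
    by (simp add: S_def u_def E_def norm_mult poly_prod prod_norm[symmetric])
  have M: "M \<ge> 0" using x by linarith
  have S': "cmod (poly (pderiv S) z) \<le> (real e + 2) * (1 + M) ^ (e + 2) * mahler_measure P"
  proof -
    have "poly (pderiv S) z = a * (\<Sum>i\<in>I. \<Prod>j\<in>I - {i}. z - \<alpha> j)"
      by (simp add: S_def pderiv_smult pderiv_prod poly_sum poly_prod pderiv_pCons)
    then have "cmod (poly (pderiv S) z) = cmod a * cmod (\<Sum>i\<in>I. \<Prod>j\<in>I - {i}. z - \<alpha> j)"
      by (simp add: norm_mult)
    also have "cmod (\<Sum>i\<in>I. \<Prod>j\<in>I - {i}. z - \<alpha> j) \<le> (\<Sum>i\<in>I. (1 + M) ^ (e + 2) * prod m {..<e + 2})"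
    proof (rule sum_norm_le)
      fix i
      \<comment> \<open>Each factor is at most (1 + M) \<open>m j\<close>. The omitted indices would
        contribute factors at least 1, so the product may run over all roots, which produces the
        Mahler measure.\<close>
      have "cmod (\<Prod>j\<in>I - {i}. z - \<alpha> j) = (\<Prod>j\<in>I - {i}. cmod (z - \<alpha> j))"
        by (simp add: prod_norm)
      also have "\<dots> \<le> (\<Prod>j\<in>I - {i}. (1 + M) * m j)"
      proof (intro prod_mono conjI)
        fix j
        have "cmod (z - \<alpha> j) \<le> cmod z + cmod (\<alpha> j)" by (rule norm_triangle_ineq4)
        also have "\<dots> \<le> M * m j + m j"
          using x mult_mono[of M M 1 "m j"] M by (intro add_mono) (auto simp: z_def m_def)
        finally show "cmod (z - \<alpha> j) \<le> (1 + M) * m j" by (simp add: algebra_simps)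
      qed auto
      also have "\<dots> \<le> (\<Prod>j<e + 2. (1 + M) * m j)"
      proof (rule prod_mono2)
        fix j
        show "1 \<le> (1 + M) * m j" using mult_mono[of 1 "1 + M" 1 "m j"] M by (simp add: m_def)
        show "0 \<le> (1 + M) * m j" using M by (simp add: m_def)
      qed (auto simp: I_def)
      finally show "cmod (\<Prod>j\<in>I - {i}. z - \<alpha> j) \<le> (1 + M) ^ (e + 2) * prod m {..<e + 2}"
        by (simp add: prod.distrib)
    qed
    also have "cmod a * \<dots> = (real e + 1) * (1 + M) ^ (e + 2) * mahler_measure P"
      by (simp add: cI mm)
    also have "\<dots> \<le> (real e + 2) * (1 + M) ^ (e + 2) * mahler_measure P"
      using M mahler_measure_ge_0 by (intro mult_right_mono) auto
    finally show ?thesis by (simp add: mult_left_mono)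
  qed
  show ?thesis
  proof
    show "u \<ge> 0" "w \<ge> 0" by (auto simp: u_def w_def E_def prod_nonneg)
    \<comment> \<open>Of the 2e + 2 factors |a|, two complete \<open>E\<close> to \<open>u\<close>
      and 2e complete the root product to the Mahler measure.\<close>
    have "cmod (discriminant P) = cmod a ^ (2 * e + 2) * (\<Prod>j<e + 2. \<Prod>i<j. cmod (\<alpha> i - \<alpha> j) ^ 2)"
      by (simp add: discriminant_def deg norm_mult norm_power prod_norm[symmetric] a_def \<alpha>_def)
    also have "\<dots> \<le> cmod a ^ (2 * e + 2) * (2 ^ ((e + 1) * (e + 2)) * E ^ 2 * prod m {..<e + 2} ^ (2 * e))"
      using prod_root_differences_le[of k e z \<alpha>, OF k] by (intro mult_left_mono) (auto simp: E_def I_def m_def)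
    also have "\<dots> = 2 ^ ((e + 1) * (e + 2)) * u ^ 2 * mahler_measure P ^ (2 * e)"
      unfolding u_def mm power_mult_distrib power_add by (simp add: mult_ac)
    finally show "cmod (discriminant P) \<le> 2 ^ ((e + 1) * (e + 2)) * u ^ 2 * mahler_measure P ^ (2 * e)" .
    have "\<bar>poly (of_int_poly P) x\<bar> = cmod (poly p z)"
      by (simp add: p_def z_def poly_of_int_poly_of_real)
    also have "poly p z = (z - \<alpha> k) * poly S z" by (simp add: pS algebra_simps)
    also have "cmod \<dots> = w * u" by (simp only: norm_mult S w_def)
    finally show "\<bar>poly (of_int_poly P) x\<bar> = w * u" .
    have "cmod (poly (pderiv p) z) = \<bar>poly (pderiv (of_int_poly P)) x\<bar>"
      by (simp add: p_def z_def poly_of_int_poly_of_real of_int_hom.map_poly_pderiv[symmetric])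
    moreover have "poly (pderiv p) z = poly S z + (z - \<alpha> k) * poly (pderiv S) z"
      unfolding pS pderiv_mult poly_add poly_mult by (simp add: pderiv_pCons algebra_simps)
    then have "u \<le> cmod (poly (pderiv p) z) + w * cmod (poly (pderiv S) z)"
      using S norm_triangle_ineq4[of "poly (pderiv p) z" "(z - \<alpha> k) * poly (pderiv S) z"]
      by (simp add: norm_mult w_def)
    moreover have "w * cmod (poly (pderiv S) z) \<le> w * ((real e + 2) * (1 + M) ^ (e + 2) * mahler_measure P)"
      using S' by (intro mult_left_mono) (auto simp: w_def)
    ultimately show "u \<le> \<bar>poly (pderiv (of_int_poly P)) x\<bar> + w * ((real e + 2) * (1 + M) ^ (e + 2) * mahler_measure P)"
      by linarith
  qed
qed

text \<open>In degree at least 2, comparing the two bounds on the discriminant leaves the cofactor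
  \<open>u\<close> at least of order H^(1 - lam), as the Mahler measure contributes at most a
  constant times H^(2(n - 2)). Then |P(x)| H \<le> 1 puts a root within 1/H of x, so |P'(x)| falls
  short of \<open>u\<close> by at most the constant \<open>G\<close>.\<close>

lemma abs_deriv_ge_of_large_discriminant:
  fixes n :: nat and \<kappa> lam M T :: real
  assumes lam: "0 < lam" "lam < 1" and \<kappa>: "\<kappa> > 0" and M: "M \<ge> 0" and T: "T \<ge> 0"
  obtains N :: real where
    "\<And>P x. P \<in> large_discriminant_polys \<kappa> n lam \<Longrightarrow> N \<le> real_of_int (height P) \<Longrightarrow> \<bar>x\<bar> \<le> M \<Longrightarrow>
       \<bar>poly (of_int_poly P) x\<bar> * real_of_int (height P) \<le> 1 \<Longrightarrow> T \<le> \<bar>poly (pderiv (of_int_poly P)) x\<bar>"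
proof -
  define G where "G = (real n + 1) ^ 2 * (1 + M) ^ n"
  have G: "G \<ge> 0" using M by (simp add: G_def)
  define c where "c = \<kappa> / (2 ^ (n * n) * (real n + 1) ^ (2 * n))"
  have c: "c > 0" using \<kappa> by (simp add: c_def)
  \<comment> \<open>This solves sqrt c * N1^(1 - lam) = T + G + 1, with positive exponent because
    lam < 1. \<open>G\<close> absorbs the derivative of the cofactor, and the extra 1 ensures u
    \<ge> 1.\<close>
  define N1 where "N1 = ((T + G + 1) / sqrt c) powr (1 / (1 - lam))"
  have N1: "T + G + 1 \<le> sqrt c * h powr (1 - lam)" if "h \<ge> N1" for h
  proof -
    have "(T + G + 1) / sqrt c = N1 powr (1 - lam)"
      using lam c T G by (simp add: N1_def powr_powr)
    also have "\<dots> \<le> h powr (1 - lam)"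
      using lam that by (intro powr_mono2) (auto simp: N1_def)
    finally show ?thesis using c by (simp add: divide_le_eq mult.commute)
  qed
  \<comment> \<open>The 2 excludes constant polynomials, T (1 + M) serves the linear ones and
    \<open>N1\<close> those of degree at least 2.\<close>
  define N where "N = max 2 (max (T * (1 + M)) N1)"
  show ?thesis
  proof
    fix P x
    assume P: "P \<in> large_discriminant_polys \<kappa> n lam" and N: "N \<le> real_of_int (height P)"
      and x: "\<bar>x\<bar> \<le> M" and Px: "\<bar>poly (of_int_poly P) x\<bar> * real_of_int (height P) \<le> 1"
    define h where "h = real_of_int (height P)"
    have h: "h \<ge> 2" "h \<ge> T * (1 + M)" "h \<ge> N1" using N by (auto simp: N_def h_def)
    have deg: "degree P \<le> n" and D: "\<kappa> * h powr (2 * (real n - 1 - lam)) \<le> cmod (discriminant P)"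
      using P by (auto simp: large_discriminant_polys_def h_def)
    have Pxh: "\<bar>poly (of_int_poly P) x\<bar> * h \<le> 1" using Px by (simp only: h_def)
    have Px': "\<bar>poly (of_int_poly P) x\<bar> \<le> 1"
      using Pxh h mult_left_mono[of 1 h "\<bar>poly (of_int_poly P) x\<bar>"] by simp
    consider "degree P = 0" | "degree P = 1" | e where "degree P = e + 2"
      by (metis One_nat_def add_2_eq_Suc' not0_implies_Suc)
    then show "T \<le> \<bar>poly (pderiv (of_int_poly P)) x\<bar>"
    proof cases
      case 1
      then obtain k where k: "P = [:k:]" by (auto elim: degree_eq_zeroE)
      have "height P \<le> \<bar>k\<bar>" by (rule height_leI) (auto simp: k)
      moreover have "\<bar>real_of_int k\<bar> \<le> 1" using Px' by (simp add: k of_int_hom.map_poly_pCons_hom)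
      ultimately show ?thesis using h unfolding h_def by linarith
    next
      case 2
      define a where "a = Polynomial.coeff P 1"
      define b where "b = Polynomial.coeff P 0"
      have ab: "P = [:b, a:]" "a \<noteq> 0"
      proof -
        show "P = [:b, a:]"
          by (rule poly_eqI) (auto simp: coeff_pCons a_def b_def coeff_eq_0 2 split: nat.split)
        show "a \<noteq> 0" using 2 by (metis a_def degree_0 leading_coeff_0_iff zero_neq_one)
      qed
      have ax: "\<bar>real_of_int b + x * real_of_int a\<bar> \<le> 1" using Px' by (simp add: ab of_int_hom.map_poly_pCons_hom)
      have a1: "\<bar>real_of_int a\<bar> \<ge> 1" using ab(2) by linarith
      have xa: "\<bar>x * real_of_int a\<bar> \<le> M * \<bar>real_of_int a\<bar>"
        using x by (simp add: abs_mult mult_right_mono)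
      \<comment> \<open>A value of modulus at most 1 at a bounded x controls the constant term by
        the leading one, so a large height makes |a|, the slope, large.\<close>
      have b: "\<bar>real_of_int b\<bar> \<le> (1 + M) * \<bar>real_of_int a\<bar>"
        using ax a1 xa by (simp add: algebra_simps)
      have a: "\<bar>real_of_int a\<bar> \<le> (1 + M) * \<bar>real_of_int a\<bar>"
        using M by (simp add: algebra_simps)
      have "height P \<le> max \<bar>a\<bar> \<bar>b\<bar>"
        by (rule height_leI) (auto simp: ab coeff_pCons split: nat.split)
      then have "h \<le> max \<bar>real_of_int a\<bar> \<bar>real_of_int b\<bar>" unfolding h_def by linarith
      then have "T * (1 + M) \<le> \<bar>real_of_int a\<bar> * (1 + M)"
        using a b h by (simp add: mult.commute)
      then have "T \<le> \<bar>real_of_int a\<bar>" using M by simp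
      then show ?thesis by (simp add: ab of_int_hom.map_poly_pCons_hom pderiv_pCons)
    next
      case (3 e)
      have n: "n \<ge> e + 2" using 3 deg by simp
      define A where "A = mahler_measure P"
      have A: "0 \<le> A" "A \<le> (real n + 1) * h"
      proof -
        show "0 \<le> A" unfolding A_def by (rule mahler_measure_ge_0)
        have "A \<le> (real (degree P) + 1) * h" unfolding A_def h_def by (rule mahler_measure_le_height)
        also have "\<dots> \<le> (real n + 1) * h" using deg h by (intro mult_right_mono) auto
        finally show "A \<le> (real n + 1) * h" .
      qed
      obtain u w where u: "u \<ge> 0" and w: "w \<ge> 0"
        and Du: "cmod (discriminant P) \<le> 2 ^ ((e + 1) * (e + 2)) * u ^ 2 * A ^ (2 * e)"
        and wu: "\<bar>poly (of_int_poly P) x\<bar> = w * u"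
        and ud: "u \<le> \<bar>poly (pderiv (of_int_poly P)) x\<bar> + w * ((real e + 2) * (1 + M) ^ (e + 2) * A)"
        unfolding A_def by (rule discriminant_le_of_nearest_root[OF 3 x])
      have "\<kappa> * h powr (2 * (real n - 1 - lam)) \<le> 2 ^ ((e + 1) * (e + 2)) * u ^ 2 * A ^ (2 * e)"
        using D Du by linarith
      \<comment> \<open>The degree e + 2 may be smaller than n; since h \<ge> 1, the exponents may
        be raised to those for n.\<close>
      also have "\<dots> \<le> 2 ^ (n * n) * u ^ 2 * ((real n + 1) ^ (2 * n) * h ^ (2 * (n - 2)))"
      proof (intro mult_mono mult_nonneg_nonneg)
        have "(e + 1) * (e + 2) \<le> n * n" using n by (intro mult_mono) auto
        then show "(2::real) ^ ((e + 1) * (e + 2)) \<le> 2 ^ (n * n)" by (intro power_increasing) auto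
        have "A ^ (2 * e) \<le> ((real n + 1) * h) ^ (2 * e)" using A by (intro power_mono) auto
        also have "\<dots> = (real n + 1) ^ (2 * e) * h ^ (2 * e)" by (rule power_mult_distrib)
        also have "\<dots> \<le> (real n + 1) ^ (2 * n) * h ^ (2 * (n - 2))"
          using n h by (intro mult_mono power_increasing) auto
        finally show "A ^ (2 * e) \<le> (real n + 1) ^ (2 * n) * h ^ (2 * (n - 2))" .
      qed (use A in auto)
      also have "h ^ (2 * (n - 2)) = h powr (2 * (real n - 2))"
        using h n by (simp add: powr_realpow[symmetric] of_nat_diff)
      finally have "\<kappa> * h powr (2 * (real n - 1 - lam))
        \<le> (2 ^ (n * n) * (real n + 1) ^ (2 * n) * u ^ 2) * h powr (2 * (real n - 2))" by (simp only: mult_ac)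
      also have "h powr (2 * (real n - 1 - lam)) = (h powr (1 - lam)) ^ 2 * h powr (2 * (real n - 2))"
        using h by (simp add: powr_power powr_add[symmetric] algebra_simps)
      finally have "\<kappa> * (h powr (1 - lam)) ^ 2 \<le> 2 ^ (n * n) * (real n + 1) ^ (2 * n) * u ^ 2"
        using h by (simp add: mult.assoc[symmetric] mult_le_cancel_right)
      then have "c * (h powr (1 - lam)) ^ 2 \<le> u ^ 2"
        unfolding c_def by (simp add: field_simps)
      then have "(sqrt c * h powr (1 - lam)) ^ 2 \<le> u ^ 2"
        using c by (simp add: power_mult_distrib)
      then have "sqrt c * h powr (1 - lam) \<le> u" using u by (rule power2_le_imp_le)
      then have u1: "T + G + 1 \<le> u" using N1[OF h(3)] by linarith
      have wh: "w * h \<le> 1"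
      proof -
        have "w * h * 1 \<le> w * h * u" using u1 G T w h by (intro mult_left_mono) auto
        also have "\<dots> \<le> 1" using Pxh wu by (simp add: mult_ac)
        finally show ?thesis by simp
      qed
      have "w * ((real e + 2) * (1 + M) ^ (e + 2) * A) \<le> w * ((real n + 1) * (1 + M) ^ n * ((real n + 1) * h))"
        using w M A n by (intro mult_left_mono mult_mono power_increasing) auto
      also have "\<dots> = G * (w * h)" by (simp add: G_def power2_eq_square mult_ac)
      also have "\<dots> \<le> G" using wh G mult_left_mono[OF wh G] by simp
      finally show ?thesis using ud u1 by linarith
    qed
  qed
qed

subsection \<open>Dyadic decomposition\<close>

text \<open>The index set stays free because two choices occur: \<open>{1..n}\<close> counts
  polynomials without constant term, and \<open>{..n}\<close> shows that bounded degree and height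
  leave only finitely many polynomials.\<close>

lemma finite_bounded_int_polys:
  fixes N :: nat
  assumes "finite I"
  defines "S \<equiv> {P :: int poly. (\<forall>i. i \<notin> I \<longrightarrow> Polynomial.coeff P i = 0) \<and> (\<forall>i. \<bar>Polynomial.coeff P i\<bar> \<le> int N)}"
  shows "finite S" "card S \<le> (2 * N + 1) ^ card I"
proof -
  define F where "F = PiE I (\<lambda>_. {- int N..int N})"
  define h where "h P = restrict (Polynomial.coeff P) I" for P :: "int poly"
  have inj: "inj_on h S"
  proof (rule inj_onI)
    fix P R assume PR: "P \<in> S" "R \<in> S" "h P = h R"
    have "Polynomial.coeff P i = Polynomial.coeff R i" for i
    proof (cases "i \<in> I")
      case True
      then show ?thesis using fun_cong[OF PR(3), of i] by (simp add: h_def)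
    next
      case False
      then show ?thesis using PR by (simp add: S_def)
    qed
    then show "P = R" by (rule poly_eqI)
  qed
  have sub: "h ` S \<subseteq> F"
    unfolding F_def h_def S_def by (force simp: abs_le_iff)
  have fin: "finite F" unfolding F_def using assms by (intro finite_PiE) auto
  have "card F = (2 * N + 1) ^ card I"
    unfolding F_def using assms by (subst card_PiE) (auto simp: nat_add_distrib nat_mult_distrib)
  then show "finite S" "card S \<le> (2 * N + 1) ^ card I"
    using inj_on_finite[OF inj sub fin] card_inj_on_le[OF inj sub fin] by auto
qed

lemma abs_poly_le:
  fixes p :: "real poly"
  assumes "degree p \<le> n" "\<And>i. \<bar>Polynomial.coeff p i\<bar> \<le> h" "\<bar>x\<bar> \<le> M"
  shows "\<bar>poly p x\<bar> \<le> (real n + 1) * h * (1 + M) ^ n"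
proof -
  have h: "h \<ge> 0" using assms(2)[of 0] by linarith
  have "\<bar>poly p x\<bar> = \<bar>\<Sum>i\<le>degree p. Polynomial.coeff p i * x ^ i\<bar>" by (simp add: poly_altdef)
  also have "\<dots> \<le> (\<Sum>i\<le>degree p. h * (1 + M) ^ n)"
  proof (rule order_trans[OF sum_abs sum_mono])
    fix i assume i: "i \<in> {..degree p}"
    have "\<bar>x\<bar> ^ i \<le> (1 + M) ^ i" using assms(3) by (intro power_mono) auto
    also have "\<dots> \<le> (1 + M) ^ n" using i assms by (intro power_increasing) auto
    finally show "\<bar>Polynomial.coeff p i * x ^ i\<bar> \<le> h * (1 + M) ^ n"
      using assms(2) h by (simp add: abs_mult power_abs mult_mono)
  qed
  also have "\<dots> = (real (degree p) + 1) * (h * (1 + M) ^ n)" by simp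
  also have "\<dots> \<le> (real n + 1) * (h * (1 + M) ^ n)"
    using assms(1,3) h by (intro mult_right_mono) auto
  finally show ?thesis by (simp only: mult.assoc)
qed

lemma abs_coeff_pderiv_le:
  fixes p :: "real poly"
  assumes "degree p \<le> n" "\<And>i. \<bar>Polynomial.coeff p i\<bar> \<le> h"
  shows "\<bar>Polynomial.coeff (pderiv p) i\<bar> \<le> real n * h"
proof (cases "Suc i \<le> n")
  case True
  then have "real (Suc i) * \<bar>Polynomial.coeff p (Suc i)\<bar> \<le> real n * h"
    using assms(2) by (intro mult_mono) auto
  then show ?thesis by (simp add: coeff_pderiv abs_mult)
next
  case False
  then have "Polynomial.coeff p (Suc i) = 0" using assms by (simp add: coeff_eq_0)
  then show ?thesis using assms(2)[of 0] by (simp add: coeff_pderiv)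
qed

section \<open>Size of g and \<psi> along the powers of two\<close>

lemma dimension_function_scale_le:
  assumes "antimono_on {0<..} (\<lambda>q. g q / q)" "c \<ge> 1" "r > 0"
  shows "g (c * r) \<le> c * g (r::real)"
proof -
  have "g (c * r) / (c * r) \<le> g r / r"
    using assms by (intro monotone_onD[OF assms(1)]) auto
  then show ?thesis using assms by (simp add: field_simps)
qed

text \<open>The factor q^n grows while the g factor decreases, so the two are estimated at opposite
  ends of a block: for q in [2^k, 2^(k+1)) the g factor is at least its value at 2^(k+1), and q^n is
  at least (2^k)^n. The dyadic term at k + 1 is thus paid for by the block before it.\<close>

lemma summable_dyadic:
  fixes \<psi> g :: "real \<Rightarrow> real"
  assumes \<psi>: "approximation_function \<psi>" and g: "dimension_function g"
    and sm: "summable (\<lambda>q. g (\<psi> (real (Suc q)) / real (Suc q)) * real (Suc q) ^ n)"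
  shows "summable (\<lambda>k. g (\<psi> (2 ^ k) / 2 ^ k) * (2 ^ k) ^ (n + 1))"
proof -
  define u where "u k = g (\<psi> (2 ^ k) / 2 ^ k) * (2 ^ k) ^ (n + 1)" for k :: nat
  define a where "a q = g (\<psi> (real q) / real q) * real q ^ n" for q :: nat
  have \<psi>pos: "\<psi> x > 0" if "x > 0" for x using \<psi> that by (simp add: approximation_function_def)
  have gpos: "g r > 0" if "r > 0" for r using g that by (simp add: dimension_function_def)
  have gmono: "mono_on {0<..} g" using g by (simp add: dimension_function_def)
  have apos: "a q \<ge> 0" if "q > 0" for q
    unfolding a_def using that \<psi>pos[of q] gpos[of "\<psi> q / q"] by simp
  have block: "u (Suc k) \<le> 2 ^ (n + 1) * sum a {2 ^ k..<2 ^ Suc k}" for k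
  proof -
    define c where "c = g (\<psi> (2 ^ Suc k) / 2 ^ Suc k) * (2 ^ k) ^ n"
    have "c \<le> a q" if q: "q \<in> {2 ^ k..<2 ^ Suc k}" for q
    proof -
      have q0: "q > 0" using q by (auto intro: Suc_le_lessD order_trans[of _ "2 ^ k"])
      have "real (2 ^ k) \<le> real q" "real q \<le> real (2 ^ Suc k)"
        using q by (auto simp only: of_nat_le_iff atLeastLessThan_iff)
      then have q1: "2 ^ k \<le> real q" and q2: "real q \<le> 2 ^ Suc k" by simp_all
      have "\<psi> (2 ^ Suc k) \<le> \<psi> q"
        using \<psi> q0 q2 unfolding approximation_function_def monotone_on_def by auto
      then have "\<psi> (2 ^ Suc k) / 2 ^ Suc k \<le> \<psi> q / q"
        using q0 q2 \<psi>pos[of q] by (intro frac_le) auto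
      then have "g (\<psi> (2 ^ Suc k) / 2 ^ Suc k) \<le> g (\<psi> q / q)"
        using q0 \<psi>pos[of q] \<psi>pos[of "2 ^ Suc k"] by (intro mono_onD[OF gmono]) auto
      moreover have "(2 ^ k) ^ n \<le> real q ^ n" using q1 by (intro power_mono) auto
      ultimately show ?thesis
        unfolding c_def a_def using gpos[of "\<psi> q / q"] \<psi>pos[of q] q0
        by (intro mult_mono) auto
    qed
    then have "of_nat (card {2 ^ k..<2 ^ Suc k :: nat}) * c \<le> sum a {2 ^ k..<2 ^ Suc k}"
      by (rule sum_bounded_below)
    then have "2 ^ (n + 1) * (2 ^ k * c) \<le> 2 ^ (n + 1) * sum a {2 ^ k..<2 ^ Suc k}" by simp
    moreover have "2 ^ (n + 1) * (2 ^ k * c) = u (Suc k)"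
      by (simp add: u_def c_def power_mult_distrib)
    ultimately show ?thesis by linarith
  qed
  have "summable (\<lambda>k. u (Suc k))"
  proof (rule summableI_nonneg_bounded)
    fix k
    show "0 \<le> u (Suc k)"
      unfolding u_def using gpos[of "\<psi> (2 ^ Suc k) / 2 ^ Suc k"] \<psi>pos[of "2 ^ Suc k"] by simp
    have "(\<Sum>i<k. u (Suc i)) \<le> (\<Sum>i<k. 2 ^ (n + 1) * sum a {2 ^ i..<2 ^ Suc i})"
      by (intro sum_mono block)
    also have "\<dots> = 2 ^ (n + 1) * sum a {1..<2 ^ k}"
    proof (induction k)
      case (Suc k)
      have "sum a {1..<2 ^ k} + sum a {2 ^ k..<2 ^ Suc k} = sum a {1..<2 ^ Suc k}"
        by (rule sum.atLeastLessThan_concat) auto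
      then show ?case unfolding sum.lessThan_Suc Suc.IH distrib_left[symmetric] by (rule arg_cong)
    qed simp
    also have "sum a {1..<2 ^ k} = (\<Sum>q<2 ^ k - 1. a (Suc q))"
    proof -
      have "{1..<2 ^ k} = Suc ` {..<2 ^ k - 1 :: nat}"
        by (simp add: lessThan_atLeast0 image_Suc_atLeastLessThan)
      then show ?thesis by (simp add: sum.reindex)
    qed
    also have "\<dots> \<le> (\<Sum>q. a (Suc q))"
    proof (rule sum_le_suminf)
      show "summable (\<lambda>q. a (Suc q))" using sm by (simp only: a_def)
      show "0 \<le> a (Suc q)" for q by (rule apos) simp
    qed simp
    finally show "(\<Sum>i<k. u (Suc i)) \<le> 2 ^ (n + 1) * (\<Sum>q. a (Suc q))" by simp
  qed
  then have "summable u" by (simp only: summable_Suc_iff)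
  then show ?thesis by (simp only: u_def[abs_def])
qed

text \<open>As g(r)/r decreases, g(r) \<ge> r g(1) for r \<le> 1. With Q = 2^k, r = \<psi>(Q)/Q and
  n \<ge> 1, Q \<psi>(Q) = r Q^2 \<le> r Q^(n+1) is at most the summand divided by g(1). This decay
  supplies |P(x)| H(P) \<le> 1 for large heights.\<close>

lemma tendsto_dyadic_approximation:
  fixes \<psi> g :: "real \<Rightarrow> real"
  assumes n: "n > 0" and \<psi>: "approximation_function \<psi>" and g: "dimension_function g"
    and anti: "antimono_on {0<..} (\<lambda>q. g q / q)"
    and sm: "summable (\<lambda>k. g (\<psi> (2 ^ k) / 2 ^ k) * (2 ^ k) ^ (n + 1))"
  shows "(\<lambda>k. 2 ^ k * \<psi> (2 ^ k)) \<longlonglongrightarrow> 0"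
proof -
  define u where "u k = g (\<psi> (2 ^ k) / 2 ^ k) * (2 ^ k) ^ (n + 1)" for k :: nat
  have \<psi>pos: "\<psi> x > 0" if "x > 0" for x using \<psi> that by (simp add: approximation_function_def)
  have g1: "g 1 > 0" using g by (simp add: dimension_function_def)
  have "u \<longlonglongrightarrow> 0" using summable_LIMSEQ_zero[OF sm] by (simp add: u_def[abs_def])
  then have lim: "(\<lambda>k. u k / g 1) \<longlonglongrightarrow> 0" using tendsto_divide[OF _ tendsto_const, of u 0 sequentially "g 1"] g1 by simp
  have "eventually (\<lambda>k. \<psi> 1 \<le> 2 ^ k) sequentially"
  proof -
    obtain k0 where "\<psi> 1 < 2 ^ k0" using real_arch_pow[of 2 "\<psi> 1"] by auto
    moreover have "(2::real) ^ k0 \<le> 2 ^ k" if "k \<ge> k0" for k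
      using that by (intro power_increasing) auto
    ultimately have "\<psi> 1 \<le> 2 ^ k" if "k \<ge> k0" for k
      using that by (meson less_imp_le less_le_trans)
    then show ?thesis by (rule eventually_sequentiallyI)
  qed
  then have "eventually (\<lambda>k. 2 ^ k * \<psi> (2 ^ k) \<le> u k / g 1) sequentially"
  proof eventually_elim
    case (elim k)
    define r where "r = \<psi> (2 ^ k) / 2 ^ k"
    have r: "r > 0" using \<psi>pos[of "2 ^ k"] by (simp add: r_def)
    have "\<psi> (2 ^ k) \<le> \<psi> 1"
      using \<psi> unfolding approximation_function_def monotone_on_def by auto
    then have "r \<le> 1" using elim by (simp add: r_def)
    then have "g (1 / r * r) \<le> 1 / r * g r"
      using r by (intro dimension_function_scale_le[OF anti]) auto
    then have "r * g 1 \<le> g r" using r by (simp add: field_simps)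
    then have "r * g 1 * (2 ^ k) ^ (n + 1) \<le> u k" unfolding u_def r_def by (rule mult_right_mono) auto
    moreover have "r * g 1 * (2 ^ k) ^ 2 \<le> r * g 1 * (2 ^ k) ^ (n + 1)"
      using r g1 n by (intro mult_left_mono power_increasing) auto
    moreover have "r * g 1 * (2 ^ k) ^ 2 = 2 ^ k * \<psi> (2 ^ k) * g 1"
      by (simp add: r_def power2_eq_square)
    ultimately have "2 ^ k * \<psi> (2 ^ k) * g 1 \<le> u k" by linarith
    then show ?case using g1 by (simp only: pos_le_divide_eq)
  qed
  then show ?thesis
    using lim by (rule tendsto_sandwich[OF _ _ tendsto_const, rotated]) (use \<psi>pos in \<open>auto intro!: always_eventually mult_nonneg_nonneg less_imp_le\<close>)
qed

text \<open>On [-M, M], C * 2Q dominates the first and second derivatives of a polynomial of degree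
  at most n with coefficients up to 2Q, so one \<open>B\<close> bounds both. As 2 Q \<psi>(Q) \<le>
  1, the condition \<open>4 * C \<le> T\<^sup>2\<close>, which is free of Q, then suffices for the
  covering estimate.\<close>

lemma hausdorff_premeasure_dyadic_le:
  fixes \<psi> g :: "real \<Rightarrow> real" and n Q :: nat and M T N \<kappa> lam \<rho> :: real
  defines "C \<equiv> (real n + 1) ^ 3 * (1 + M) ^ n"
  assumes \<psi>: "approximation_function \<psi>" and g: "dimension_function g"
    and anti: "antimono_on {0<..} (\<lambda>q. g q / q)"
    and M: "M \<ge> 0" and T: "T > 0" "4 * C \<le> T\<^sup>2"
    and large: "\<And>P x. P \<in> large_discriminant_polys \<kappa> n lam \<Longrightarrow> N \<le> real_of_int (height P) \<Longrightarrow> \<bar>x\<bar> \<le> M \<Longrightarrow>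
       \<bar>poly (of_int_poly P) x\<bar> * real_of_int (height P) \<le> 1 \<Longrightarrow> T \<le> \<bar>poly (pderiv (of_int_poly P)) x\<bar>"
    and Q: "Q > 0" "N \<le> real Q" "2 * (real Q * \<psi> (real Q)) \<le> 1" "\<psi> (real Q) \<le> 1/4" "5 * \<psi> (real Q) / T \<le> \<rho>"
  shows "hausdorff_premeasure g \<rho> {x. \<bar>x\<bar> \<le> M \<and> (\<exists>P\<in>large_discriminant_polys \<kappa> n lam.
            int Q \<le> height P \<and> height P < 2 * int Q \<and> \<bar>poly (of_int_poly P) x\<bar> \<le> \<psi> (real_of_int (height P)))}
    \<le> ennreal (5 ^ n * (2 * real n + 1) * 10 * C * (1 / T + 4 * M) * (g (\<psi> (real Q) / real Q) * real Q ^ (n + 1)))"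
proof -
  define \<delta> where "\<delta> = \<psi> (real Q)"
  define B where "B = C * (2 * real Q)"
  define S where "S = {P :: int poly. (\<forall>i. i \<notin> {1..n} \<longrightarrow> Polynomial.coeff P i = 0)
      \<and> (\<forall>i. \<bar>Polynomial.coeff P i\<bar> \<le> int (2 * Q))}"
  define Y where "Y R = {x. \<bar>x\<bar> \<le> M \<and> (\<exists>b::int. \<bar>poly (of_int_poly R) x + of_int b\<bar> \<le> \<delta>)
      \<and> T \<le> \<bar>poly (pderiv (of_int_poly R)) x\<bar>}" for R
  have C: "C \<ge> 1"
    using M mult_mono[of 1 "(real n + 1) ^ 3" 1 "(1 + M) ^ n"] by (simp add: C_def)
  have B: "B > 0" "real Q \<le> B"
    using C Q(1) mult_mono[of 1 C "real Q" "2 * real Q"] by (auto simp: B_def)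
  have \<delta>: "\<delta> > 0" using \<psi> Q(1) by (simp add: \<delta>_def approximation_function_def)
  have gpos: "g r > 0" if "r > 0" for r using g that by (simp add: dimension_function_def)
  define c where "c = (2 * real n + 1) * (5 * B * g (\<delta> / Q) * (1 / T + 4 * M))"
  have c: "c \<ge> 0"
    unfolding c_def using B gpos[of "\<delta> / Q"] \<delta> M T Q by (intro mult_nonneg_nonneg) auto
  have YR: "hausdorff_premeasure g \<rho> (Y R) \<le> ennreal c" if R: "R \<in> S" for R
  proof -
    define p where "p = (of_int_poly R :: real poly)"
    have deg: "degree p \<le> n"
      unfolding p_def using R by (intro degree_le) (auto simp: S_def)
    have co: "\<bar>Polynomial.coeff p i\<bar> \<le> 2 * real Q" for i
    proof -
      have "\<bar>Polynomial.coeff R i\<bar> \<le> int (2 * Q)" using R by (simp add: S_def)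
      then show ?thesis unfolding p_def by simp
    qed
    have deg': "degree (pderiv p) \<le> n" "degree (pderiv (pderiv p)) \<le> n"
      using deg by (auto simp: degree_pderiv)
    have co': "\<bar>Polynomial.coeff (pderiv p) i\<bar> \<le> real n * (2 * real Q)" for i
      by (rule abs_coeff_pderiv_le[OF deg co])
    have co'': "\<bar>Polynomial.coeff (pderiv (pderiv p)) i\<bar> \<le> real n * (real n * (2 * real Q))" for i
      by (rule abs_coeff_pderiv_le[OF deg'(1) co'])
    have p1: "\<bar>poly (pderiv p) x\<bar> \<le> B" if x: "\<bar>x\<bar> \<le> M" for x
    proof -
      have "\<bar>poly (pderiv p) x\<bar> \<le> (real n + 1) * (real n * (2 * real Q)) * (1 + M) ^ n"
        by (rule abs_poly_le[OF deg'(1) co' x])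
      also have "\<dots> \<le> (real n + 1) * ((real n + 1) * (real n + 1) * (2 * real Q)) * (1 + M) ^ n"
        using M mult_mono[of 1 "real n + 1" "real n" "real n + 1"]
        by (intro mult_right_mono mult_left_mono) auto
      also have "\<dots> = B" by (simp add: B_def C_def power3_eq_cube)
      finally show ?thesis .
    qed
    have p2: "\<bar>poly (pderiv (pderiv p)) x\<bar> \<le> B" if x: "\<bar>x\<bar> \<le> M" for x
    proof -
      have "\<bar>poly (pderiv (pderiv p)) x\<bar> \<le> (real n + 1) * (real n * (real n * (2 * real Q))) * (1 + M) ^ n"
        by (rule abs_poly_le[OF deg'(2) co'' x])
      also have "\<dots> \<le> (real n + 1) * ((real n + 1) * ((real n + 1) * (2 * real Q))) * (1 + M) ^ n"
        using M by (intro mult_right_mono mult_left_mono mult_mono) auto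
      also have "\<dots> = B" by (simp add: B_def C_def power3_eq_cube)
      finally show ?thesis .
    qed
    have "4 * B * \<delta> \<le> T\<^sup>2"
    proof -
      have "4 * B * \<delta> = 4 * C * (2 * (real Q * \<psi> (real Q)))" by (simp add: B_def \<delta>_def)
      also have "\<dots> \<le> 4 * C * 1" using Q(3) C by (intro mult_left_mono) auto
      finally show ?thesis using T(2) by simp
    qed
    then have "hausdorff_premeasure g \<rho> (Y R) \<le> ennreal ((2 * real n + 1) * (5 * B * g (\<delta> / B) * (1 / T + 4 * M)))"
      unfolding Y_def p_def[symmetric]
      by (intro hausdorff_premeasure_near_integer_le[where K = B, OF deg M T(1) \<delta>] p1 p2 gpos
            dimension_function_scale_le[OF anti] B(1)) (use Q in \<open>auto simp: \<delta>_def\<close>)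
    also have "\<dots> \<le> ennreal c"
    proof -
      \<comment> \<open>\<open>B\<close> is at least Q and g increases, so \<delta>/B may be
        replaced by the argument \<psi>(Q)/Q of the series.\<close>
      have "mono_on {0<..} g" using g by (simp add: dimension_function_def)
      then have "g (\<delta> / B) \<le> g (\<delta> / Q)"
        using \<delta> B Q by (intro mono_onD[of "{0<..}" g]) (auto simp: frac_le)
      then show ?thesis
        unfolding c_def using B M T by (intro ennreal_leI mult_left_mono mult_right_mono) auto
    qed
    finally show ?thesis .
  qed
  have "{x. \<bar>x\<bar> \<le> M \<and> (\<exists>P\<in>large_discriminant_polys \<kappa> n lam.
            int Q \<le> height P \<and> height P < 2 * int Q \<and> \<bar>poly (of_int_poly P) x\<bar> \<le> \<psi> (real_of_int (height P)))}
      \<subseteq> (\<Union>R\<in>S. Y R)"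
  proof
    fix x assume "x \<in> {x. \<bar>x\<bar> \<le> M \<and> (\<exists>P\<in>large_discriminant_polys \<kappa> n lam.
            int Q \<le> height P \<and> height P < 2 * int Q \<and> \<bar>poly (of_int_poly P) x\<bar> \<le> \<psi> (real_of_int (height P)))}"
    then obtain P where x: "\<bar>x\<bar> \<le> M" and P: "P \<in> large_discriminant_polys \<kappa> n lam"
      and h: "int Q \<le> height P" "height P < 2 * int Q" and Px: "\<bar>poly (of_int_poly P) x\<bar> \<le> \<psi> (real_of_int (height P))"
      by blast
    define h' where "h' = real_of_int (height P)"
    have h': "real Q \<le> h'" "h' \<le> 2 * real Q" using h unfolding h'_def by linarith+
    have "\<psi> h' \<le> \<delta>"
      using \<psi> Q(1) h' unfolding \<delta>_def approximation_function_def monotone_on_def by auto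
    then have Px\<delta>: "\<bar>poly (of_int_poly P) x\<bar> \<le> \<delta>" using Px unfolding h'_def by linarith
    \<comment> \<open>The height is below 2Q, so |P(x)| H(P) \<le> 2 Q \<psi>(Q) \<le> 1, the
      premise for the lower bound on the derivative.\<close>
    have "\<bar>poly (of_int_poly P) x\<bar> * h' \<le> \<delta> * (2 * real Q)"
      using Px\<delta> h' \<delta> by (intro mult_mono) auto
    then have "\<bar>poly (of_int_poly P) x\<bar> * h' \<le> 1" using Q(3) unfolding \<delta>_def by argo
    then have T': "T \<le> \<bar>poly (pderiv (of_int_poly P)) x\<bar>"
      using large[OF P _ x] h' Q(2) unfolding h'_def by linarith
    \<comment> \<open>\<open>R\<close> has the derivative of \<open>P\<close>, and its value at x is
      within \<delta> of the integer -P(0).\<close>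
    define R where "R = P - [:Polynomial.coeff P 0:]"
    have PR: "P = R + [:Polynomial.coeff P 0:]" by (simp add: R_def)
    have "R \<in> S"
      unfolding S_def
    proof (intro CollectI conjI allI impI)
      fix i assume "i \<notin> {1..n}"
      then have "i = 0 \<or> i > n" by auto
      then show "Polynomial.coeff R i = 0"
        using P by (auto simp: R_def coeff_pCons large_discriminant_polys_def coeff_eq_0 split: nat.split)
    next
      fix i
      have "\<bar>Polynomial.coeff P i\<bar> \<le> int (2 * Q)" using abs_coeff_le_height[of P i] h by linarith
      then show "\<bar>Polynomial.coeff R i\<bar> \<le> int (2 * Q)" by (auto simp: R_def coeff_pCons split: nat.split)
    qed
    moreover have ev: "poly (of_int_poly P) x = poly (of_int_poly R) x + of_int (Polynomial.coeff P 0)"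
      by (subst PR) (simp add: of_int_hom.map_poly_pCons_hom of_int_poly_hom.hom_add)
    moreover have "pderiv (of_int_poly P :: real poly) = pderiv (of_int_poly R)"
      by (subst PR) (simp add: of_int_hom.map_poly_pCons_hom of_int_poly_hom.hom_add pderiv_add pderiv_pCons)
    ultimately have "x \<in> Y R"
      using x Px\<delta> T' unfolding Y_def by auto
    then show "x \<in> (\<Union>R\<in>S. Y R)" using \<open>R \<in> S\<close> by blast
  qed
  then have "hausdorff_premeasure g \<rho> {x. \<bar>x\<bar> \<le> M \<and> (\<exists>P\<in>large_discriminant_polys \<kappa> n lam.
            int Q \<le> height P \<and> height P < 2 * int Q \<and> \<bar>poly (of_int_poly P) x\<bar> \<le> \<psi> (real_of_int (height P)))}
      \<le> hausdorff_premeasure g \<rho> (\<Union>R\<in>S. Y R)"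
    by (rule hausdorff_premeasure_mono)
  also have "\<dots> \<le> (\<Sum>R\<in>S. hausdorff_premeasure g \<rho> (Y R))"
    by (rule hausdorff_premeasure_finite_UN_le) (simp only: S_def finite_bounded_int_polys finite_atLeastAtMost)
  also have "\<dots> \<le> (\<Sum>R\<in>S. ennreal c)" by (intro sum_mono YR)
  also have "\<dots> = ennreal (real (card S) * c)"
    using c by (simp add: ennreal_mult' ennreal_of_nat_eq_real_of_nat)
  also have "\<dots> \<le> ennreal ((5 * real Q) ^ n * c)"
  proof (intro ennreal_leI mult_right_mono c)
    have "card S \<le> (2 * (2 * Q) + 1) ^ card {1..n}"
      unfolding S_def by (rule finite_bounded_int_polys) simp
    also have "\<dots> = (4 * Q + 1) ^ n" by simp
    also have "\<dots> \<le> (5 * Q) ^ n" using Q(1) by (intro power_mono) auto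
    finally have "real (card S) \<le> real ((5 * Q) ^ n)" by (simp only: of_nat_le_iff)
    then show "real (card S) \<le> (5 * real Q) ^ n" by simp
  qed
  also have "(5 * real Q) ^ n * c = 5 ^ n * (2 * real n + 1) * 10 * C * (1 / T + 4 * M) * (g (\<psi> (real Q) / real Q) * real Q ^ (n + 1))"
    by (simp add: c_def B_def \<delta>_def power_mult_distrib)
  finally show ?thesis .
qed

section \<open>Borel-Cantelli argument on bounded sets and exhaustion of the line\<close>

theorem theorem3:
  fixes n :: nat and lam \<kappa> :: real and \<psi> g :: "real \<Rightarrow> real"
  assumes "n > 0" and "0 < lam" "lam < 1" and "\<kappa> > 0"
    and "approximation_function \<psi>"
    and "dimension_function g"
    and "antimono_on {0<..} (\<lambda>q. g q / q)"
    and "filterlim (\<lambda>q. g q / q) at_top (at_right 0)"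
    and "summable (\<lambda>q. g (\<psi> (real (Suc q)) / real (Suc q)) * real (Suc q) ^ n)"
  shows "hausdorff_measure g (approximable_reals \<kappa> n lam \<psi>) = 0"
proof -
  note \<psi> = assms(5) and g = assms(6) and anti = assms(7)
  define u where "u k = g (\<psi> (2 ^ k) / 2 ^ k) * (2 ^ k) ^ (n + 1)" for k :: nat
  define A where "A = approximable_reals \<kappa> n lam \<psi>"
  have u: "summable u" unfolding u_def[abs_def] by (rule summable_dyadic[OF \<psi> g assms(9)])
  have upos: "u k \<ge> 0" for k
    using \<psi> g unfolding u_def approximation_function_def dimension_function_def
    by (intro mult_nonneg_nonneg less_imp_le) auto
  have lim: "(\<lambda>k. 2 ^ k * \<psi> (2 ^ k)) \<longlonglongrightarrow> 0"
    by (rule tendsto_dyadic_approximation[OF assms(1) \<psi> g anti]) (use u in \<open>simp add: u_def[abs_def]\<close>)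
  have bounded_null: "hausdorff_premeasure g \<rho> (A \<inter> {x. \<bar>x\<bar> \<le> M}) = 0" if M: "M \<ge> 0" and \<rho>: "\<rho> > 0" for M \<rho>
  proof -
    define C where "C = (real n + 1) ^ 3 * (1 + M) ^ n"
    have C: "C \<ge> 1"
      using M mult_mono[of 1 "(real n + 1) ^ 3" 1 "(1 + M) ^ n"] by (simp add: C_def)
    \<comment> \<open>As C \<ge> 1, the square 4 C^2 is at least 4 C. This choice precedes
      \<open>N\<close>, which depends on T.\<close>
    define T where "T = 2 * C"
    have T: "T > 0" "4 * C \<le> T\<^sup>2"
      using C mult_mono[of 1 C 1 C] by (auto simp: T_def power2_eq_square)
    obtain N where N: "\<And>P x. P \<in> large_discriminant_polys \<kappa> n lam \<Longrightarrow> N \<le> real_of_int (height P) \<Longrightarrow> \<bar>x\<bar> \<le> M \<Longrightarrow>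
       \<bar>poly (of_int_poly P) x\<bar> * real_of_int (height P) \<le> 1 \<Longrightarrow> T \<le> \<bar>poly (pderiv (of_int_poly P)) x\<bar>"
      using abs_deriv_ge_of_large_discriminant[OF assms(2-4) M less_imp_le[OF T(1)]] by blast
    define Z where "Z k = {x. \<bar>x\<bar> \<le> M \<and> (\<exists>P\<in>large_discriminant_polys \<kappa> n lam.
            int (2 ^ k) \<le> height P \<and> height P < 2 * int (2 ^ k) \<and>
            \<bar>poly (of_int_poly P) x\<bar> \<le> \<psi> (real_of_int (height P)))}" for k
    define D where "D = 5 ^ n * (2 * real n + 1) * 10 * C * (1 / T + 4 * M)"
    have D: "D \<ge> 0" unfolding D_def using C T M by (intro mult_nonneg_nonneg) auto
    \<comment> \<open>The 1/4 gives both \<psi>(Q) \<le> 1/4 and 2 Q \<psi>(Q) \<le> 1; the other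
      bound keeps the radii 5 \<psi>(Q) / T within \<rho>.\<close>
    define \<eta> where "\<eta> = min (1/4) (\<rho> * T / 5)"
    have \<eta>: "\<eta> > 0" using \<rho> T by (simp add: \<eta>_def)
    have "eventually (\<lambda>k. 2 ^ k * \<psi> (2 ^ k) < \<eta>) sequentially"
      using order_tendstoD(2)[OF lim \<eta>] .
    moreover have "eventually (\<lambda>k. N \<le> 2 ^ k) sequentially"
    proof -
      obtain k0 where "N < 2 ^ k0" using real_arch_pow[of 2 N] by auto
      moreover have "(2::real) ^ k0 \<le> 2 ^ k" if "k \<ge> k0" for k
        using that by (intro power_increasing) auto
      ultimately have "N \<le> 2 ^ k" if "k \<ge> k0" for k
        using that by (meson less_imp_le less_le_trans)
      then show ?thesis by (rule eventually_sequentiallyI)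
    qed
    ultimately have "eventually (\<lambda>k. hausdorff_premeasure g \<rho> (Z k) \<le> ennreal (D * u k)) sequentially"
    proof eventually_elim
      case (elim k)
      have pos: "\<psi> (2 ^ k) > 0" using \<psi> by (simp add: approximation_function_def)
      have le: "\<psi> (2 ^ k) \<le> 2 ^ k * \<psi> (2 ^ k)" using pos by simp
      have "hausdorff_premeasure g \<rho> (Z k) \<le> ennreal (5 ^ n * (2 * real n + 1) * 10 * C * (1 / T + 4 * M) *
          (g (\<psi> (real (2 ^ k)) / real (2 ^ k)) * real (2 ^ k) ^ (n + 1)))"
        unfolding Z_def C_def
      proof (rule hausdorff_premeasure_dyadic_le[OF \<psi> g anti M T(1)])
        show "4 * ((real n + 1) ^ 3 * (1 + M) ^ n) \<le> T\<^sup>2" using T(2) by (simp only: C_def)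
        show "5 * \<psi> (real (2 ^ k)) / T \<le> \<rho>"
          using elim(1) le T by (simp add: \<eta>_def divide_le_eq)
      qed (use N elim le in \<open>auto simp: \<eta>_def\<close>)
      then show ?case by (simp add: D_def u_def)
    qed
    then obtain k0 where k0: "\<And>k. k \<ge> k0 \<Longrightarrow> hausdorff_premeasure g \<rho> (Z k) \<le> ennreal (D * u k)"
      by (auto simp: eventually_sequentially)
    have cover: "A \<inter> {x. \<bar>x\<bar> \<le> M} \<subseteq> (\<Union>i. Z (i + k))" for k
    proof
      fix x assume x: "x \<in> A \<inter> {x. \<bar>x\<bar> \<le> M}"
      define W where "W = {P \<in> large_discriminant_polys \<kappa> n lam. \<bar>poly (of_int_poly P) x\<bar> \<le> \<psi> (real_of_int (height P))}"
      have inf: "infinite W" using x by (simp add: A_def approximable_reals_def W_def)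
      \<comment> \<open>Only finitely many polynomials have degree at most n and height at most 2^k,
        so the infinite set \<open>W\<close> reaches beyond; the dyadic block of such a height has
        index at least k.\<close>
      have "\<exists>P\<in>W. height P \<ge> int (2 ^ k)"
      proof (rule ccontr)
        assume neg: "\<not> ?thesis"
        have "W \<subseteq> {P. (\<forall>i. i \<notin> {..n} \<longrightarrow> Polynomial.coeff P i = 0) \<and> (\<forall>i. \<bar>Polynomial.coeff P i\<bar> \<le> int (2 ^ k))}"
        proof
          fix P assume P: "P \<in> W"
          then have "height P \<le> int (2 ^ k)" using neg by (meson linear)
          then have "\<bar>Polynomial.coeff P i\<bar> \<le> int (2 ^ k)" for i
            using abs_coeff_le_height[of P i] by linarith
          then show "P \<in> {P. (\<forall>i. i \<notin> {..n} \<longrightarrow> Polynomial.coeff P i = 0) \<and> (\<forall>i. \<bar>Polynomial.coeff P i\<bar> \<le> int (2 ^ k))}"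
            using P by (auto simp: W_def large_discriminant_polys_def coeff_eq_0)
        qed
        then show False using inf finite_bounded_int_polys(1)[of "{..n}" "2 ^ k"] finite_subset by blast
      qed
      then obtain P where P: "P \<in> W" "height P \<ge> int (2 ^ k)" by blast
      define h where "h = nat (height P)"
      have h: "int h = height P" by (simp add: h_def)
      have hk: "2 ^ k \<le> h" using P(2) h by linarith
      have "h \<ge> 1" using hk by (metis le_trans one_le_numeral one_le_power)
      then obtain m where m: "2 ^ m \<le> h" "h < 2 ^ (m + 1)" using ex_power_ivl1[of 2 h] by auto
      have "2 ^ k < (2::nat) ^ (m + 1)" using hk m by linarith
      then have "k < m + 1" by (rule power_less_imp_less_exp[rotated]) simp
      then have "k \<le> m" by simp
      moreover have "int (2 ^ m) \<le> height P" "height P < 2 * int (2 ^ m)"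
      proof -
        have "int (2 ^ m) \<le> int h" using m(1) by (simp only: of_nat_le_iff)
        then show "int (2 ^ m) \<le> height P" using h by linarith
        have "int h < int (2 * 2 ^ m)" using m(2) by (simp only: of_nat_less_iff power_add power_one_right mult.commute)
        then show "height P < 2 * int (2 ^ m)" using h by linarith
      qed
      then have "x \<in> Z m" using P x by (auto simp: Z_def W_def)
      ultimately show "x \<in> (\<Union>i. Z (i + k))" by (auto intro!: exI[of _ "m - k"])
    qed
    \<comment> \<open>The blocks from any index on cover the set, so its cost is at most a tail of a
      convergent series.\<close>
    have "hausdorff_premeasure g \<rho> (A \<inter> {x. \<bar>x\<bar> \<le> M}) \<le> 0 + ennreal \<epsilon>" if \<epsilon>: "\<epsilon> > 0" for \<epsilon>
    proof -
      have Du: "summable (\<lambda>k. D * u k)" using u by (rule summable_mult)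
      obtain k1 where k1: "\<And>k. k \<ge> k1 \<Longrightarrow> norm (\<Sum>i. D * u (i + k)) < \<epsilon>"
        using suminf_exist_split[OF \<epsilon> Du] by blast
      define k where "k = max k0 k1"
      have "hausdorff_premeasure g \<rho> (A \<inter> {x. \<bar>x\<bar> \<le> M}) \<le> hausdorff_premeasure g \<rho> (\<Union>i. Z (i + k))"
        by (rule hausdorff_premeasure_mono[OF cover])
      also have "\<dots> \<le> (\<Sum>i. hausdorff_premeasure g \<rho> (Z (i + k)))"
        by (rule hausdorff_premeasure_UN_le)
      also have "\<dots> \<le> (\<Sum>i. ennreal (D * u (i + k)))"
        by (intro suminf_le k0) (auto simp: k_def)
      also have "\<dots> = ennreal (\<Sum>i. D * u (i + k))"
        using Du D upos by (intro suminf_ennreal2) (auto simp: summable_iff_shift)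
      also have "\<dots> \<le> ennreal \<epsilon>"
        using k1[of k] by (intro ennreal_leI) (auto simp: k_def)
      finally show ?thesis by simp
    qed
    then have "hausdorff_premeasure g \<rho> (A \<inter> {x. \<bar>x\<bar> \<le> M}) \<le> 0" by (rule ennreal_le_epsilon)
    then show ?thesis by simp
  qed
  have "hausdorff_premeasure g \<rho> A = 0" if \<rho>: "\<rho> > 0" for \<rho>
  proof -
    have "A = (\<Union>m::nat. A \<inter> {x. \<bar>x\<bar> \<le> real m})"
      using real_arch_simple by blast
    then have "hausdorff_premeasure g \<rho> A \<le> (\<Sum>m. hausdorff_premeasure g \<rho> (A \<inter> {x. \<bar>x\<bar> \<le> real m}))"
      using hausdorff_premeasure_UN_le[of g \<rho> "\<lambda>m. A \<inter> {x. \<bar>x\<bar> \<le> real m}"] by simp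
    then show ?thesis using bounded_null[OF _ \<rho>] by simp
  qed
  then show ?thesis
    unfolding hausdorff_measure_eq_SUP A_def by (simp add: SUP_constant)
qed

end
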